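(* Let $\mathcal K$ be a 2-category with comma objects and pullbacks. (1) Let $f : A \to C$ and $g : B \to C$ be arrows of $\mathcal K$ with pullback $P$ and projections $p : P \to A$, $q : P \to B$. The pullback square $fp = gq$ (with the identity 2-cell $fp \to gq$) is exact if $f$ is an opfibration or $g$ is a fibration. (2) If moreover $\mathcal K$ admits isocomma objects, then a bipullback square given by $p : P \to A$, $q : P \to B$, $f : A \to C$, $g : B \to C$ and an isomorphism $fp \cong gq$ (with the invertible 2-cell oriented as $fp \to gq$) is exact if $f$ is a bi-opfibration or $g$ is a bi-fibration.
   Context: **Kan extensions and exactness.** In a 2-category $\mathcal K$ with comma objects, a 2-cell $\psi : g \to hf$ (with $f : X \to Y$, $g : X \to A$, $h : Y \to A$) exhibits $h$ as a left Kan extension of $g$ along $f$ if for every $k : Y \to A$, pasting with $\psi$ is a bijection between 2-cells $h \to k$ and 2-cells $g \to kf$. It is pointwise if for every $k : Z \to Y$, with comma square $p : f\downarrow k \to X$, $q : f \downarrow k \to Z$, $\lambda : fp \to kq$, the 2-cell $(h\lambda)(\psi p) : gp \to hkq$ exhibits $hk$ as a left Kan extension of $gp$ along $q$. A lax square $p : P \to A$, $q : P \to B$, $f : A \to C$, $g : B \to C$, $\phi : fp \to gq$ is exact if for every $\psi : h \to lf$ exhibiting $l$ as a pointwise left Kan extension of $h$ along $f$, the 2-cell $(l\phi)(\psi p) : hp \to lgq$ exhibits $lg$ as a pointwise left Kan extension of $hp$ along $q$. **Fibrations in a 2-category.** $g : B \to C$ is a fibration if for every object $X$ the functor $\mathcal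 K(X,g) : \mathcal K(X,B) \to \mathcal K(X,C)$ is a Grothendieck fibration and for every $Y \to X$ the functor $\mathcal K(X,B) \to \mathcal K(Y,B)$ given by precomposition preserves cartesian arrows. It is a bi-fibration if the same holds with the fibration condition weakened so that cartesian lifts are only required to exist up to isomorphism (i.e. for $\beta : c \to gb$ there is a cartesian $\bar\beta : b' \to b$ and an isomorphism $c \cong gb'$ compatible with $\beta$ and $g\bar\beta$). Opfibrations and bi-opfibrations are the duals (fibrations and bi-fibrations in $\mathcal K^{\mathrm{co}}$, obtained by reversing 2-cells). **Isocommas and bipullbacks.** The isocomma object $f\downarrow_{\cong} g$ has the universal property of the comma object, but only with respect to squares over $f$ and $g$ containing an invertible 2-cell. A square commuting up to an isomorphism $fp \cong gq$ is a bipullback if the induced arrow $P \to f\downarrow_{\cong} g$ is an equivalence in $\mathcal K$. *)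

theory Defs
  imports Main
begin

section \<open>Categories and functors\<close>

record ('a, 'c) cat =
  Obj :: "'a set"
  Arr :: "'c set"
  Dom :: "'c \<Rightarrow> 'a"
  Cod :: "'c \<Rightarrow> 'a"
  Ident :: "'a \<Rightarrow> 'c"
  Comp :: "'c \<Rightarrow> 'c \<Rightarrow> 'c"  \<comment> \<open>\<open>Comp C g f\<close> is \<open>g\<close> after \<open>f\<close>\<close>

definition hom :: "('a, 'c) cat \<Rightarrow> 'a \<Rightarrow> 'a \<Rightarrow> 'c set" where
  "hom C a b = {f \<in> Arr C. Dom C f = a \<and> Cod C f = b}"

locale category =
  fixes C :: "('a, 'c) cat"
  assumes dom_obj: "f \<in> Arr C \<Longrightarrow> Dom C f \<in> Obj C"
    and cod_obj: "f \<in> Arr C \<Longrightarrow> Cod C f \<in> Obj C"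
    and ident_hom: "a \<in> Obj C \<Longrightarrow> Ident C a \<in> hom C a a"
    and comp_hom: "f \<in> hom C a b \<Longrightarrow> g \<in> hom C b c \<Longrightarrow> Comp C g f \<in> hom C a c"
    and ident_left: "f \<in> hom C a b \<Longrightarrow> Comp C (Ident C b) f = f"
    and ident_right: "f \<in> hom C a b \<Longrightarrow> Comp C f (Ident C a) = f"
    and comp_assoc: "f \<in> hom C a b \<Longrightarrow> g \<in> hom C b c \<Longrightarrow> h \<in> hom C c d
      \<Longrightarrow> Comp C h (Comp C g f) = Comp C (Comp C h g) f"

definition isos :: "('a, 'c) cat \<Rightarrow> 'c set" where
  "isos C = {f \<in> Arr C. \<exists>g \<in> hom C (Cod C f) (Dom C f).
     Comp C g f = Ident C (Dom C f) \<and> Comp C f g = Ident C (Cod C f)}"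

definition op_cat :: "('a, 'c) cat \<Rightarrow> ('a, 'c) cat" where
  "op_cat C = \<lparr>Obj = Obj C, Arr = Arr C, Dom = Cod C, Cod = Dom C, Ident = Ident C,
     Comp = (\<lambda>g f. Comp C f g)\<rparr>"

record ('a, 'c, 'b, 'd) func =
  on_obj :: "'a \<Rightarrow> 'b"
  on_arr :: "'c \<Rightarrow> 'd"

definition is_functor :: "('a, 'c) cat \<Rightarrow> ('b, 'd) cat \<Rightarrow> ('a, 'c, 'b, 'd) func \<Rightarrow> bool" where
  "is_functor C D F \<longleftrightarrow>
     (\<forall>a \<in> Obj C. on_obj F a \<in> Obj D \<and> on_arr F (Ident C a) = Ident D (on_obj F a)) \<and>
     (\<forall>a b. \<forall>f \<in> hom C a b. on_arr F f \<in> hom D (on_obj F a) (on_obj F b)) \<and>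
     (\<forall>a b c. \<forall>f \<in> hom C a b. \<forall>g \<in> hom C b c.
        on_arr F (Comp C g f) = Comp D (on_arr F g) (on_arr F f))"

text \<open>\<open>\<phi> : b' \<rightarrow> b\<close> is cartesian: every \<open>\<psi> : b'' \<rightarrow> b\<close> whose image factors as \<open>F \<psi> = F \<phi> \<circ> \<chi>\<close>
  factors uniquely through \<open>\<phi>\<close> by an arrow over \<open>\<chi>\<close>.\<close>

definition cartesian ::
    "('a, 'c) cat \<Rightarrow> ('b, 'd) cat \<Rightarrow> ('a, 'c, 'b, 'd) func \<Rightarrow> 'c \<Rightarrow> bool" where
  "cartesian C D F \<phi> \<longleftrightarrow> \<phi> \<in> Arr C \<and>
     (\<forall>b'' \<in> Obj C. \<forall>\<psi> \<in> hom C b'' (Cod C \<phi>).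
        \<forall>\<chi> \<in> hom D (on_obj F b'') (on_obj F (Dom C \<phi>)).
          Comp D (on_arr F \<phi>) \<chi> = on_arr F \<psi> \<longrightarrow>
          (\<exists>!\<omega>. \<omega> \<in> hom C b'' (Dom C \<phi>) \<and> Comp C \<phi> \<omega> = \<psi> \<and> on_arr F \<omega> = \<chi>))"

definition grothendieck_fibration ::
    "('a, 'c) cat \<Rightarrow> ('b, 'd) cat \<Rightarrow> ('a, 'c, 'b, 'd) func \<Rightarrow> bool" where
  "grothendieck_fibration C D F \<longleftrightarrow> is_functor C D F \<and>
     (\<forall>b \<in> Obj C. \<forall>c. \<forall>\<beta> \<in> hom D c (on_obj F b).
        \<exists>b' \<in> Obj C. \<exists>\<phi> \<in> hom C b' b.
          cartesian C D F \<phi> \<and> on_obj F b' = c \<and> on_arr F \<phi> = \<beta>)"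

definition weak_grothendieck_fibration ::
    "('a, 'c) cat \<Rightarrow> ('b, 'd) cat \<Rightarrow> ('a, 'c, 'b, 'd) func \<Rightarrow> bool" where
  "weak_grothendieck_fibration C D F \<longleftrightarrow> is_functor C D F \<and>
     (\<forall>b \<in> Obj C. \<forall>c. \<forall>\<beta> \<in> hom D c (on_obj F b).
        \<exists>b' \<in> Obj C. \<exists>\<phi> \<in> hom C b' b. \<exists>\<theta> \<in> hom D c (on_obj F b') \<inter> isos D.
          cartesian C D F \<phi> \<and> Comp D (on_arr F \<phi>) \<theta> = \<beta>)"


section \<open>2-categories\<close>

text \<open>A strict 2-category consists of the category of objects and arrows, the category of arrows
  and 2-cells under vertical composition, and horizontal composition of 2-cells.\<close>

record ('o, 'a, 'c) two_cat =
  ucat :: "('o, 'a) cat"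
  vcat :: "('a, 'c) cat"
  hcomp :: "'c \<Rightarrow> 'c \<Rightarrow> 'c"  (infixr "\<star>\<index>" 75)

abbreviation comp1 :: "('o, 'a, 'c) two_cat \<Rightarrow> 'a \<Rightarrow> 'a \<Rightarrow> 'a"  (infixr "\<cdot>\<index>" 75) where
  "g \<cdot>\<^bsub>K\<^esub> f \<equiv> Comp (ucat K) g f"

abbreviation vcomp :: "('o, 'a, 'c) two_cat \<Rightarrow> 'c \<Rightarrow> 'c \<Rightarrow> 'c"  (infixr "\<bullet>\<index>" 70) where
  "\<beta> \<bullet>\<^bsub>K\<^esub> \<alpha> \<equiv> Comp (vcat K) \<beta> \<alpha>"

abbreviation hom1 :: "('o, 'a, 'c) two_cat \<Rightarrow> 'o \<Rightarrow> 'o \<Rightarrow> 'a set" where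
  "hom1 K \<equiv> hom (ucat K)"

abbreviation hom2 :: "('o, 'a, 'c) two_cat \<Rightarrow> 'a \<Rightarrow> 'a \<Rightarrow> 'c set" where
  "hom2 K \<equiv> hom (vcat K)"

abbreviation dom1 :: "('o, 'a, 'c) two_cat \<Rightarrow> 'a \<Rightarrow> 'o" where
  "dom1 K \<equiv> Dom (ucat K)"

abbreviation cod1 :: "('o, 'a, 'c) two_cat \<Rightarrow> 'a \<Rightarrow> 'o" where
  "cod1 K \<equiv> Cod (ucat K)"

abbreviation id1 :: "('o, 'a, 'c) two_cat \<Rightarrow> 'o \<Rightarrow> 'a" where
  "id1 K \<equiv> Ident (ucat K)"

abbreviation id2 :: "('o, 'a, 'c) two_cat \<Rightarrow> 'a \<Rightarrow> 'c" where
  "id2 K \<equiv> Ident (vcat K)"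

abbreviation whisker_left :: "('o, 'a, 'c) two_cat \<Rightarrow> 'a \<Rightarrow> 'c \<Rightarrow> 'c"  (infixr "\<rhd>\<index>" 75) where
  "g \<rhd>\<^bsub>K\<^esub> \<alpha> \<equiv> id2 K g \<star>\<^bsub>K\<^esub> \<alpha>"

abbreviation whisker_right :: "('o, 'a, 'c) two_cat \<Rightarrow> 'c \<Rightarrow> 'a \<Rightarrow> 'c"  (infixr "\<lhd>\<index>" 75) where
  "\<alpha> \<lhd>\<^bsub>K\<^esub> f \<equiv> \<alpha> \<star>\<^bsub>K\<^esub> id2 K f"

locale two_category =
  fixes K :: "('o, 'a, 'c) two_cat" (structure)
  assumes ucat: "category (ucat K)"
    and vcat: "category (vcat K)"
    and vcat_obj: "Obj (vcat K) = Arr (ucat K)"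
    and parallel_dom: "\<alpha> \<in> Arr (vcat K) \<Longrightarrow> dom1 K (Dom (vcat K) \<alpha>) = dom1 K (Cod (vcat K) \<alpha>)"
    and parallel_cod: "\<alpha> \<in> Arr (vcat K) \<Longrightarrow> cod1 K (Dom (vcat K) \<alpha>) = cod1 K (Cod (vcat K) \<alpha>)"
    and hcomp_hom: "\<lbrakk>f \<in> hom1 K X Y; g \<in> hom1 K Y Z; \<alpha> \<in> hom2 K f f'; \<beta> \<in> hom2 K g g'\<rbrakk>
      \<Longrightarrow> \<beta> \<star> \<alpha> \<in> hom2 K (g \<cdot> f) (g' \<cdot> f')"
    and hcomp_ident: "\<lbrakk>f \<in> hom1 K X Y; g \<in> hom1 K Y Z\<rbrakk> \<Longrightarrow> id2 K g \<star> id2 K f = id2 K (g \<cdot> f)"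
    and interchange: "\<lbrakk>f \<in> hom1 K X Y; g \<in> hom1 K Y Z; \<alpha> \<in> hom2 K f f'; \<alpha>' \<in> hom2 K f' f'';
        \<beta> \<in> hom2 K g g'; \<beta>' \<in> hom2 K g' g''\<rbrakk>
      \<Longrightarrow> (\<beta>' \<bullet> \<beta>) \<star> (\<alpha>' \<bullet> \<alpha>) = (\<beta>' \<star> \<alpha>') \<bullet> (\<beta> \<star> \<alpha>)"
    and hcomp_assoc: "\<lbrakk>f \<in> hom1 K W X; g \<in> hom1 K X Y; h \<in> hom1 K Y Z;
        \<alpha> \<in> hom2 K f f'; \<beta> \<in> hom2 K g g'; \<gamma> \<in> hom2 K h h'\<rbrakk>
      \<Longrightarrow> \<gamma> \<star> (\<beta> \<star> \<alpha>) = (\<gamma> \<star> \<beta>) \<star> \<alpha>"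
    and hcomp_unit_left: "\<lbrakk>f \<in> hom1 K X Y; \<alpha> \<in> hom2 K f f'\<rbrakk> \<Longrightarrow> id2 K (id1 K Y) \<star> \<alpha> = \<alpha>"
    and hcomp_unit_right: "\<lbrakk>f \<in> hom1 K X Y; \<alpha> \<in> hom2 K f f'\<rbrakk> \<Longrightarrow> \<alpha> \<star> id2 K (id1 K X) = \<alpha>"

text \<open>\<open>K\<^sup>c\<^sup>o\<close>: 2-cells reversed, arrows unchanged.\<close>

definition co_dual :: "('o, 'a, 'c) two_cat \<Rightarrow> ('o, 'a, 'c) two_cat" where
  "co_dual K = \<lparr>ucat = ucat K, vcat = op_cat (vcat K), hcomp = hcomp K\<rparr>"

definition hom_cat :: "('o, 'a, 'c) two_cat \<Rightarrow> 'o \<Rightarrow> 'o \<Rightarrow> ('a, 'c) cat" where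
  "hom_cat K X Y = \<lparr>Obj = hom1 K X Y, Arr = {\<alpha> \<in> Arr (vcat K). Dom (vcat K) \<alpha> \<in> hom1 K X Y},
     Dom = Dom (vcat K), Cod = Cod (vcat K), Ident = Ident (vcat K), Comp = Comp (vcat K)\<rparr>"

definition post :: "('o, 'a, 'c) two_cat \<Rightarrow> 'a \<Rightarrow> ('a, 'c, 'a, 'c) func" where
  "post K g = \<lparr>on_obj = (\<lambda>b. g \<cdot>\<^bsub>K\<^esub> b), on_arr = (\<lambda>\<beta>. g \<rhd>\<^bsub>K\<^esub> \<beta>)\<rparr>"

definition pre :: "('o, 'a, 'c) two_cat \<Rightarrow> 'a \<Rightarrow> ('a, 'c, 'a, 'c) func" where
  "pre K y = \<lparr>on_obj = (\<lambda>b. b \<cdot>\<^bsub>K\<^esub> y), on_arr = (\<lambda>\<beta>. \<beta> \<lhd>\<^bsub>K\<^esub> y)\<rparr>"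

definition equivalence :: "('o, 'a, 'c) two_cat \<Rightarrow> 'a \<Rightarrow> bool" where
  "equivalence K u \<longleftrightarrow> u \<in> Arr (ucat K) \<and>
     (\<exists>v \<in> hom1 K (cod1 K u) (dom1 K u).
        hom2 K (v \<cdot>\<^bsub>K\<^esub> u) (id1 K (dom1 K u)) \<inter> isos (vcat K) \<noteq> {} \<and>
        hom2 K (u \<cdot>\<^bsub>K\<^esub> v) (id1 K (cod1 K u)) \<inter> isos (vcat K) \<noteq> {})"


section \<open>Commas, isocommas, pullbacks and bipullbacks\<close>

definition lax_square :: "('o, 'a, 'c) two_cat \<Rightarrow> 'a \<Rightarrow> 'a \<Rightarrow> 'a \<Rightarrow> 'a \<Rightarrow> 'c \<Rightarrow> bool" where
  "lax_square K f g p q \<phi> \<longleftrightarrow>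
     (\<exists>P A B C. p \<in> hom1 K P A \<and> q \<in> hom1 K P B \<and> f \<in> hom1 K A C \<and> g \<in> hom1 K B C \<and>
        \<phi> \<in> hom2 K (f \<cdot>\<^bsub>K\<^esub> p) (g \<cdot>\<^bsub>K\<^esub> q))"

text \<open>The (1- and 2-dimensional) universal property of a comma object, with respect to
  the squares whose 2-cell lies in \<open>S\<close>.\<close>

definition comma_wrt ::
    "'c set \<Rightarrow> ('o, 'a, 'c) two_cat \<Rightarrow> 'a \<Rightarrow> 'a \<Rightarrow> 'a \<Rightarrow> 'a \<Rightarrow> 'c \<Rightarrow> bool" where
  "comma_wrt S K f g p q \<phi> \<longleftrightarrow> lax_square K f g p q \<phi> \<and> \<phi> \<in> S \<and>
     (\<forall>u v \<alpha>. lax_square K f g u v \<alpha> \<and> \<alpha> \<in> S \<longrightarrow>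
        (\<exists>!h. h \<in> hom1 K (dom1 K u) (dom1 K p) \<and>
           p \<cdot>\<^bsub>K\<^esub> h = u \<and> q \<cdot>\<^bsub>K\<^esub> h = v \<and> \<phi> \<lhd>\<^bsub>K\<^esub> h = \<alpha>)) \<and>
     (\<forall>X. \<forall>h \<in> hom1 K X (dom1 K p). \<forall>k \<in> hom1 K X (dom1 K p).
        \<forall>\<alpha> \<in> hom2 K (p \<cdot>\<^bsub>K\<^esub> h) (p \<cdot>\<^bsub>K\<^esub> k). \<forall>\<beta> \<in> hom2 K (q \<cdot>\<^bsub>K\<^esub> h) (q \<cdot>\<^bsub>K\<^esub> k).
          (\<phi> \<lhd>\<^bsub>K\<^esub> k) \<bullet>\<^bsub>K\<^esub> (f \<rhd>\<^bsub>K\<^esub> \<alpha>) = (g \<rhd>\<^bsub>K\<^esub> \<beta>) \<bullet>\<^bsub>K\<^esub> (\<phi> \<lhd>\<^bsub>K\<^esub> h) \<longrightarrow>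
          (\<exists>!\<gamma>. \<gamma> \<in> hom2 K h k \<and> p \<rhd>\<^bsub>K\<^esub> \<gamma> = \<alpha> \<and> q \<rhd>\<^bsub>K\<^esub> \<gamma> = \<beta>))"

definition is_comma :: "('o, 'a, 'c) two_cat \<Rightarrow> 'a \<Rightarrow> 'a \<Rightarrow> 'a \<Rightarrow> 'a \<Rightarrow> 'c \<Rightarrow> bool" where
  "is_comma K = comma_wrt (Arr (vcat K)) K"

definition is_isocomma :: "('o, 'a, 'c) two_cat \<Rightarrow> 'a \<Rightarrow> 'a \<Rightarrow> 'a \<Rightarrow> 'a \<Rightarrow> 'c \<Rightarrow> bool" where
  "is_isocomma K = comma_wrt (isos (vcat K)) K"

text \<open>Pullbacks are strict 2-limits: they are universal both for arrows and for 2-cells.\<close>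

definition is_pullback :: "('o, 'a, 'c) two_cat \<Rightarrow> 'a \<Rightarrow> 'a \<Rightarrow> 'a \<Rightarrow> 'a \<Rightarrow> bool" where
  "is_pullback K f g p q \<longleftrightarrow>
     (\<exists>P A B C. p \<in> hom1 K P A \<and> q \<in> hom1 K P B \<and> f \<in> hom1 K A C \<and> g \<in> hom1 K B C \<and>
        f \<cdot>\<^bsub>K\<^esub> p = g \<cdot>\<^bsub>K\<^esub> q \<and>
        (\<forall>X. \<forall>u \<in> hom1 K X A. \<forall>v \<in> hom1 K X B. f \<cdot>\<^bsub>K\<^esub> u = g \<cdot>\<^bsub>K\<^esub> v \<longrightarrow>
           (\<exists>!h. h \<in> hom1 K X P \<and> p \<cdot>\<^bsub>K\<^esub> h = u \<and> q \<cdot>\<^bsub>K\<^esub> h = v)) \<and>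
        (\<forall>X. \<forall>h \<in> hom1 K X P. \<forall>k \<in> hom1 K X P.
           \<forall>\<alpha> \<in> hom2 K (p \<cdot>\<^bsub>K\<^esub> h) (p \<cdot>\<^bsub>K\<^esub> k). \<forall>\<beta> \<in> hom2 K (q \<cdot>\<^bsub>K\<^esub> h) (q \<cdot>\<^bsub>K\<^esub> k).
             f \<rhd>\<^bsub>K\<^esub> \<alpha> = g \<rhd>\<^bsub>K\<^esub> \<beta> \<longrightarrow>
             (\<exists>!\<gamma>. \<gamma> \<in> hom2 K h k \<and> p \<rhd>\<^bsub>K\<^esub> \<gamma> = \<alpha> \<and> q \<rhd>\<^bsub>K\<^esub> \<gamma> = \<beta>)))"

definition is_bipullback :: "('o, 'a, 'c) two_cat \<Rightarrow> 'a \<Rightarrow> 'a \<Rightarrow> 'a \<Rightarrow> 'a \<Rightarrow> 'c \<Rightarrow> bool" where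
  "is_bipullback K f g p q \<phi> \<longleftrightarrow> lax_square K f g p q \<phi> \<and> \<phi> \<in> isos (vcat K) \<and>
     (\<exists>r s \<kappa>. is_isocomma K f g r s \<kappa> \<and>
        (\<exists>u \<in> hom1 K (dom1 K p) (dom1 K r).
           r \<cdot>\<^bsub>K\<^esub> u = p \<and> s \<cdot>\<^bsub>K\<^esub> u = q \<and> \<kappa> \<lhd>\<^bsub>K\<^esub> u = \<phi> \<and> equivalence K u))"

definition has_commas :: "('o, 'a, 'c) two_cat \<Rightarrow> bool" where
  "has_commas K \<longleftrightarrow> (\<forall>A B C. \<forall>f \<in> hom1 K A C. \<forall>g \<in> hom1 K B C. \<exists>p q \<phi>. is_comma K f g p q \<phi>)"

definition has_isocommas :: "('o, 'a, 'c) two_cat \<Rightarrow> bool" where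
  "has_isocommas K \<longleftrightarrow>
     (\<forall>A B C. \<forall>f \<in> hom1 K A C. \<forall>g \<in> hom1 K B C. \<exists>p q \<phi>. is_isocomma K f g p q \<phi>)"

definition has_pullbacks :: "('o, 'a, 'c) two_cat \<Rightarrow> bool" where
  "has_pullbacks K \<longleftrightarrow> (\<forall>A B C. \<forall>f \<in> hom1 K A C. \<forall>g \<in> hom1 K B C. \<exists>p q. is_pullback K f g p q)"


section \<open>Kan extensions and exact squares\<close>

text \<open>\<open>\<psi> : g \<rightarrow> h f\<close> exhibits \<open>h\<close> as a left Kan extension of \<open>g\<close> along \<open>f\<close>.\<close>

definition left_kan :: "('o, 'a, 'c) two_cat \<Rightarrow> 'a \<Rightarrow> 'a \<Rightarrow> 'a \<Rightarrow> 'c \<Rightarrow> bool" where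
  "left_kan K f g h \<psi> \<longleftrightarrow>
     (\<exists>X Y A. f \<in> hom1 K X Y \<and> g \<in> hom1 K X A \<and> h \<in> hom1 K Y A \<and> \<psi> \<in> hom2 K g (h \<cdot>\<^bsub>K\<^esub> f) \<and>
        (\<forall>k \<in> hom1 K Y A.
           bij_betw (\<lambda>\<chi>. (\<chi> \<lhd>\<^bsub>K\<^esub> f) \<bullet>\<^bsub>K\<^esub> \<psi>) (hom2 K h k) (hom2 K g (k \<cdot>\<^bsub>K\<^esub> f))))"

definition pointwise_left_kan :: "('o, 'a, 'c) two_cat \<Rightarrow> 'a \<Rightarrow> 'a \<Rightarrow> 'a \<Rightarrow> 'c \<Rightarrow> bool" where
  "pointwise_left_kan K f g h \<psi> \<longleftrightarrow> left_kan K f g h \<psi> \<and>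
     (\<forall>k p q \<kappa>. is_comma K f k p q \<kappa> \<longrightarrow>
        left_kan K q (g \<cdot>\<^bsub>K\<^esub> p) (h \<cdot>\<^bsub>K\<^esub> k) ((h \<rhd>\<^bsub>K\<^esub> \<kappa>) \<bullet>\<^bsub>K\<^esub> (\<psi> \<lhd>\<^bsub>K\<^esub> p)))"

definition exact :: "('o, 'a, 'c) two_cat \<Rightarrow> 'a \<Rightarrow> 'a \<Rightarrow> 'a \<Rightarrow> 'a \<Rightarrow> 'c \<Rightarrow> bool" where
  "exact K f g p q \<phi> \<longleftrightarrow> lax_square K f g p q \<phi> \<and>
     (\<forall>h l \<psi>. pointwise_left_kan K f h l \<psi> \<longrightarrow>
        pointwise_left_kan K q (h \<cdot>\<^bsub>K\<^esub> p) (l \<cdot>\<^bsub>K\<^esub> g) ((l \<rhd>\<^bsub>K\<^esub> \<phi>) \<bullet>\<^bsub>K\<^esub> (\<psi> \<lhd>\<^bsub>K\<^esub> p)))"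


section \<open>Fibrations in a 2-category\<close>

definition pre_preserves_cartesian :: "('o, 'a, 'c) two_cat \<Rightarrow> 'a \<Rightarrow> bool" where
  "pre_preserves_cartesian K g \<longleftrightarrow>
     (\<forall>X Y. \<forall>y \<in> hom1 K Y X. \<forall>\<beta>.
        cartesian (hom_cat K X (dom1 K g)) (hom_cat K X (cod1 K g)) (post K g) \<beta> \<longrightarrow>
        cartesian (hom_cat K Y (dom1 K g)) (hom_cat K Y (cod1 K g)) (post K g) (on_arr (pre K y) \<beta>))"

definition fibration :: "('o, 'a, 'c) two_cat \<Rightarrow> 'a \<Rightarrow> bool" where
  "fibration K g \<longleftrightarrow> g \<in> Arr (ucat K) \<and>
     (\<forall>X \<in> Obj (ucat K).
        grothendieck_fibration (hom_cat K X (dom1 K g)) (hom_cat K X (cod1 K g)) (post K g)) \<and>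
     pre_preserves_cartesian K g"

definition bi_fibration :: "('o, 'a, 'c) two_cat \<Rightarrow> 'a \<Rightarrow> bool" where
  "bi_fibration K g \<longleftrightarrow> g \<in> Arr (ucat K) \<and>
     (\<forall>X \<in> Obj (ucat K).
        weak_grothendieck_fibration (hom_cat K X (dom1 K g)) (hom_cat K X (cod1 K g)) (post K g)) \<and>
     pre_preserves_cartesian K g"

definition opfibration :: "('o, 'a, 'c) two_cat \<Rightarrow> 'a \<Rightarrow> bool" where
  "opfibration K = fibration (co_dual K)"

definition bi_opfibration :: "('o, 'a, 'c) two_cat \<Rightarrow> 'a \<Rightarrow> bool" where
  "bi_opfibration K = bi_fibration (co_dual K)"

end

theory Submission
  imports Defs
begin

text \<open>Given \<open>k : Z \<rightarrow> B\<close>, the square induces a comparison \<open>m : q\<down>k \<rightarrow> f\<down>gk\<close> over \<open>Z\<close>, and it is exact as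
  soon as whiskering with each such \<open>m\<close> is a bijection from 2-cells \<open>G \<rightarrow> F s\<close> to 2-cells
  \<open>G m \<rightarrow> F s m\<close>, where \<open>s : f\<down>gk \<rightarrow> Z\<close> is the projection. For this, \<open>m\<close> need not be part of an
  adjunction: it suffices to have \<open>n\<close> in the opposite direction and 2-cells \<open>\<eta> : 1 \<rightarrow> m n\<close>,
  \<open>\<theta> : 1 \<rightarrow> n m\<close> with \<open>m \<theta> = \<eta> m\<close> and \<open>s \<eta>\<close> an identity. Such data arise whenever each 2-cell
  \<open>\<gamma> : f u \<rightarrow> g v\<close> factors as \<open>(g \<tau>)(\<phi> t)(f \<rho>)\<close> with \<open>\<rho> : u \<rightarrow> p t\<close> and \<open>\<tau> : q t \<rightarrow> v\<close>, where \<open>\<tau>\<close>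
  has the existence part of the cartesian property after every precomposition. If \<open>g\<close> is a
  (bi-)fibration, \<open>\<tau>\<close> is a cartesian lift of \<open>\<gamma>\<close> up to isomorphism; if \<open>f\<close> is a (bi-)opfibration,
  \<open>\<rho>\<close> is a lift of \<open>\<gamma>\<close> and \<open>\<tau>\<close> is invertible.\<close>

text \<open>Uniqueness of \<open>\<omega>\<close> is deliberately not demanded, so that invertible 2-cells and cartesian
  2-cells can be treated alike.\<close>

definition stably_lifting :: "('o, 'a, 'c) two_cat \<Rightarrow> 'a \<Rightarrow> 'c \<Rightarrow> bool" where
  "stably_lifting K g \<tau> \<longleftrightarrow>
     (\<forall>Y. \<forall>y \<in> hom1 K Y (dom1 K (Dom (vcat K) \<tau>)). \<forall>w \<in> hom1 K Y (cod1 K (Dom (vcat K) \<tau>)).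
        \<forall>\<xi> \<in> hom2 K w (Cod (vcat K) \<tau> \<cdot>\<^bsub>K\<^esub> y).
        \<forall>\<chi> \<in> hom2 K (g \<cdot>\<^bsub>K\<^esub> w) (g \<cdot>\<^bsub>K\<^esub> (Dom (vcat K) \<tau> \<cdot>\<^bsub>K\<^esub> y)).
          (g \<rhd>\<^bsub>K\<^esub> (\<tau> \<lhd>\<^bsub>K\<^esub> y)) \<bullet>\<^bsub>K\<^esub> \<chi> = g \<rhd>\<^bsub>K\<^esub> \<xi> \<longrightarrow>
          (\<exists>\<omega> \<in> hom2 K w (Dom (vcat K) \<tau> \<cdot>\<^bsub>K\<^esub> y). (\<tau> \<lhd>\<^bsub>K\<^esub> y) \<bullet>\<^bsub>K\<^esub> \<omega> = \<xi> \<and> g \<rhd>\<^bsub>K\<^esub> \<omega> = \<chi>))"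

context two_category
begin

section \<open>Calculus of arrows and 2-cells in a 2-category\<close>

lemma arr1_obj [simp]:
  assumes "f \<in> Arr (ucat K)"
  shows "dom1 K f \<in> Obj (ucat K)" "cod1 K f \<in> Obj (ucat K)"
  using category.dom_obj[OF ucat assms] category.cod_obj[OF ucat assms] by auto

lemma id1_simps [simp]:
  assumes "X \<in> Obj (ucat K)"
  shows "id1 K X \<in> Arr (ucat K)" "dom1 K (id1 K X) = X" "cod1 K (id1 K X) = X"
  using category.ident_hom[OF ucat assms] by (auto simp: hom_def)

text \<open>The axioms carry source and target objects that the simplifier would have to guess. Here
  and below they are recast with conditions on \<open>Arr\<close>, \<open>Dom\<close> and
  \<open>Cod\<close>, which rewriting discharges by itself. Compositions are nested to the right,
  iterated whiskerings merge into one, and whiskering is distributed over vertical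
  composites.\<close>

lemma comp1_simps [simp]:
  assumes "g \<in> Arr (ucat K)" "f \<in> Arr (ucat K)" "dom1 K g = cod1 K f"
  shows "g \<cdot> f \<in> Arr (ucat K)" "dom1 K (g \<cdot> f) = dom1 K f" "cod1 K (g \<cdot> f) = cod1 K g"
  using category.comp_hom[OF ucat, of f "dom1 K f" "cod1 K f" g "cod1 K g"] assms
  by (auto simp: hom_def)

lemma comp1_id [simp]:
  assumes "f \<in> Arr (ucat K)"
  shows "cod1 K f = X \<Longrightarrow> id1 K X \<cdot> f = f" "dom1 K f = X \<Longrightarrow> f \<cdot> id1 K X = f"
  using category.ident_left[OF ucat, of f "dom1 K f" "cod1 K f"]
    category.ident_right[OF ucat, of f "dom1 K f" "cod1 K f"] assms
  by (auto simp: hom_def)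

lemma comp1_assoc [simp]:
  assumes "h \<in> Arr (ucat K)" "g \<in> Arr (ucat K)" "f \<in> Arr (ucat K)"
    "dom1 K g = cod1 K f" "dom1 K h = cod1 K g"
  shows "(h \<cdot> g) \<cdot> f = h \<cdot> (g \<cdot> f)"
  using category.comp_assoc[OF ucat, of f "dom1 K f" "cod1 K f" g "cod1 K g" h "cod1 K h"] assms
  by (auto simp: hom_def)

lemma arr2_simps [simp]:
  assumes "\<alpha> \<in> Arr (vcat K)"
  shows "Dom (vcat K) \<alpha> \<in> Arr (ucat K)" "Cod (vcat K) \<alpha> \<in> Arr (ucat K)"
    "dom1 K (Cod (vcat K) \<alpha>) = dom1 K (Dom (vcat K) \<alpha>)"
    "cod1 K (Cod (vcat K) \<alpha>) = cod1 K (Dom (vcat K) \<alpha>)"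
  using category.dom_obj[OF vcat assms] category.cod_obj[OF vcat assms] vcat_obj
    parallel_dom[OF assms] parallel_cod[OF assms] by auto

lemma id2_simps [simp]:
  assumes "f \<in> Arr (ucat K)"
  shows "id2 K f \<in> Arr (vcat K)" "Dom (vcat K) (id2 K f) = f" "Cod (vcat K) (id2 K f) = f"
  using category.ident_hom[OF vcat, of f] assms vcat_obj by (auto simp: hom_def)

lemma vcomp_simps [simp]:
  assumes "\<beta> \<in> Arr (vcat K)" "\<alpha> \<in> Arr (vcat K)" "Dom (vcat K) \<beta> = Cod (vcat K) \<alpha>"
  shows "\<beta> \<bullet> \<alpha> \<in> Arr (vcat K)" "Dom (vcat K) (\<beta> \<bullet> \<alpha>) = Dom (vcat K) \<alpha>"
    "Cod (vcat K) (\<beta> \<bullet> \<alpha>) = Cod (vcat K) \<beta>"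
  using category.comp_hom[OF vcat, of \<alpha> "Dom (vcat K) \<alpha>" "Cod (vcat K) \<alpha>" \<beta> "Cod (vcat K) \<beta>"]
    assms by (auto simp: hom_def)

lemma vcomp_id [simp]:
  assumes "\<alpha> \<in> Arr (vcat K)"
  shows "Cod (vcat K) \<alpha> = f \<Longrightarrow> id2 K f \<bullet> \<alpha> = \<alpha>" "Dom (vcat K) \<alpha> = f \<Longrightarrow> \<alpha> \<bullet> id2 K f = \<alpha>"
  using category.ident_left[OF vcat, of \<alpha> "Dom (vcat K) \<alpha>" "Cod (vcat K) \<alpha>"]
    category.ident_right[OF vcat, of \<alpha> "Dom (vcat K) \<alpha>" "Cod (vcat K) \<alpha>"] assms
  by (auto simp: hom_def)

lemma vcomp_assoc [simp]:
  assumes "\<gamma> \<in> Arr (vcat K)" "\<beta> \<in> Arr (vcat K)" "\<alpha> \<in> Arr (vcat K)"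
    "Dom (vcat K) \<beta> = Cod (vcat K) \<alpha>" "Dom (vcat K) \<gamma> = Cod (vcat K) \<beta>"
  shows "(\<gamma> \<bullet> \<beta>) \<bullet> \<alpha> = \<gamma> \<bullet> (\<beta> \<bullet> \<alpha>)"
  using category.comp_assoc[OF vcat, of \<alpha> "Dom (vcat K) \<alpha>" "Cod (vcat K) \<alpha>" \<beta> "Cod (vcat K) \<beta>"
      \<gamma> "Cod (vcat K) \<gamma>"] assms
  by (auto simp: hom_def)

lemma hcomp_simps [simp]:
  assumes "\<beta> \<in> Arr (vcat K)" "\<alpha> \<in> Arr (vcat K)"
    "dom1 K (Dom (vcat K) \<beta>) = cod1 K (Dom (vcat K) \<alpha>)"
  shows "\<beta> \<star> \<alpha> \<in> Arr (vcat K)"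
    "Dom (vcat K) (\<beta> \<star> \<alpha>) = Dom (vcat K) \<beta> \<cdot> Dom (vcat K) \<alpha>"
    "Cod (vcat K) (\<beta> \<star> \<alpha>) = Cod (vcat K) \<beta> \<cdot> Cod (vcat K) \<alpha>"
  using hcomp_hom[of "Dom (vcat K) \<alpha>" "dom1 K (Dom (vcat K) \<alpha>)" "cod1 K (Dom (vcat K) \<alpha>)"
      "Dom (vcat K) \<beta>" "cod1 K (Dom (vcat K) \<beta>)" \<alpha> "Cod (vcat K) \<alpha>" \<beta> "Cod (vcat K) \<beta>"] assms
  by (auto simp: hom_def)

lemma whisker_id2 [simp]:
  assumes "g \<in> Arr (ucat K)" "f \<in> Arr (ucat K)" "dom1 K g = cod1 K f"
  shows "g \<rhd> id2 K f = id2 K (g \<cdot> f)"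
  using hcomp_ident[of f "dom1 K f" "cod1 K f" g "cod1 K g"] assms by (auto simp: hom_def)

lemma interchange_arr:
  assumes "\<beta>' \<in> Arr (vcat K)" "\<beta> \<in> Arr (vcat K)" "\<alpha>' \<in> Arr (vcat K)" "\<alpha> \<in> Arr (vcat K)"
    "Dom (vcat K) \<beta>' = Cod (vcat K) \<beta>" "Dom (vcat K) \<alpha>' = Cod (vcat K) \<alpha>"
    "dom1 K (Dom (vcat K) \<beta>) = cod1 K (Dom (vcat K) \<alpha>)"
  shows "(\<beta>' \<bullet> \<beta>) \<star> (\<alpha>' \<bullet> \<alpha>) = (\<beta>' \<star> \<alpha>') \<bullet> (\<beta> \<star> \<alpha>)"
  by (rule interchange[of "Dom (vcat K) \<alpha>" "dom1 K (Dom (vcat K) \<alpha>)" "cod1 K (Dom (vcat K) \<alpha>)"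
      "Dom (vcat K) \<beta>" "cod1 K (Dom (vcat K) \<beta>)" \<alpha> "Cod (vcat K) \<alpha>" \<alpha>' "Cod (vcat K) \<alpha>'"
      \<beta> "Cod (vcat K) \<beta>" \<beta>' "Cod (vcat K) \<beta>'"]) (use assms in \<open>auto simp: hom_def\<close>)

lemma hcomp_assoc_arr [simp]:
  assumes "\<gamma> \<in> Arr (vcat K)" "\<beta> \<in> Arr (vcat K)" "\<alpha> \<in> Arr (vcat K)"
    "dom1 K (Dom (vcat K) \<beta>) = cod1 K (Dom (vcat K) \<alpha>)"
    "dom1 K (Dom (vcat K) \<gamma>) = cod1 K (Dom (vcat K) \<beta>)"
  shows "(\<gamma> \<star> \<beta>) \<star> \<alpha> = \<gamma> \<star> (\<beta> \<star> \<alpha>)"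
  by (rule hcomp_assoc[of "Dom (vcat K) \<alpha>" "dom1 K (Dom (vcat K) \<alpha>)" "cod1 K (Dom (vcat K) \<alpha>)"
      "Dom (vcat K) \<beta>" "cod1 K (Dom (vcat K) \<beta>)" "Dom (vcat K) \<gamma>" "cod1 K (Dom (vcat K) \<gamma>)"
      \<alpha> "Cod (vcat K) \<alpha>" \<beta> "Cod (vcat K) \<beta>" \<gamma> "Cod (vcat K) \<gamma>", symmetric])
    (use assms in \<open>auto simp: hom_def\<close>)

lemma whisker_id1 [simp]:
  assumes "\<alpha> \<in> Arr (vcat K)"
  shows "cod1 K (Dom (vcat K) \<alpha>) = X \<Longrightarrow> id1 K X \<rhd> \<alpha> = \<alpha>"
    "dom1 K (Dom (vcat K) \<alpha>) = X \<Longrightarrow> \<alpha> \<lhd> id1 K X = \<alpha>"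
  using hcomp_unit_left[of "Dom (vcat K) \<alpha>" "dom1 K (Dom (vcat K) \<alpha>)" _ \<alpha> "Cod (vcat K) \<alpha>"]
    hcomp_unit_right[of "Dom (vcat K) \<alpha>" _ "cod1 K (Dom (vcat K) \<alpha>)" \<alpha> "Cod (vcat K) \<alpha>"] assms
  by (auto simp: hom_def)

lemma whisker_left_vcomp [simp]:
  assumes "g \<in> Arr (ucat K)" "\<beta> \<in> Arr (vcat K)" "\<alpha> \<in> Arr (vcat K)"
    "Dom (vcat K) \<beta> = Cod (vcat K) \<alpha>" "dom1 K g = cod1 K (Dom (vcat K) \<alpha>)"
  shows "g \<rhd> (\<beta> \<bullet> \<alpha>) = (g \<rhd> \<beta>) \<bullet> (g \<rhd> \<alpha>)"
  using interchange_arr[of "id2 K g" "id2 K g" \<beta> \<alpha>] assms by simp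

lemma whisker_right_vcomp [simp]:
  assumes "f \<in> Arr (ucat K)" "\<beta> \<in> Arr (vcat K)" "\<alpha> \<in> Arr (vcat K)"
    "Dom (vcat K) \<beta> = Cod (vcat K) \<alpha>" "dom1 K (Dom (vcat K) \<alpha>) = cod1 K f"
  shows "(\<beta> \<bullet> \<alpha>) \<lhd> f = (\<beta> \<lhd> f) \<bullet> (\<alpha> \<lhd> f)"
  using interchange_arr[of \<beta> \<alpha> "id2 K f" "id2 K f"] assms by simp

lemma whisker_whisker [simp]:
  assumes "h \<in> Arr (ucat K)" "g \<in> Arr (ucat K)" "\<alpha> \<in> Arr (vcat K)"
    "dom1 K h = cod1 K g" "dom1 K g = cod1 K (Dom (vcat K) \<alpha>)"
  shows "h \<rhd> (g \<rhd> \<alpha>) = (h \<cdot> g) \<rhd> \<alpha>"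
  using hcomp_assoc_arr[of "id2 K h" "id2 K g" \<alpha>] assms by simp

text \<open>Both sides equal \<open>\<beta> \<star> \<alpha>\<close>, by interchange against
  identities. The boundary arrows are separate variables tied by equations, so that the rule unifies
  with goals in which they are already in normal form.\<close>

lemma whisker_exchange:
  assumes "\<beta> \<in> Arr (vcat K)" "\<alpha> \<in> Arr (vcat K)"
    "dom1 K (Dom (vcat K) \<beta>) = cod1 K (Dom (vcat K) \<alpha>)"
    "a = Dom (vcat K) \<alpha>" "a' = Cod (vcat K) \<alpha>" "b = Dom (vcat K) \<beta>" "b' = Cod (vcat K) \<beta>"
  shows "(b' \<rhd> \<alpha>) \<bullet> (\<beta> \<lhd> a) = (\<beta> \<lhd> a') \<bullet> (b \<rhd> \<alpha>)"
proof -
  have "(b' \<rhd> \<alpha>) \<bullet> (\<beta> \<lhd> a) = (id2 K b' \<bullet> \<beta>) \<star> (\<alpha> \<bullet> id2 K a)"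
    by (rule interchange_arr[symmetric]) (simp_all add: assms)
  also have "\<dots> = (\<beta> \<bullet> id2 K b) \<star> (id2 K a' \<bullet> \<alpha>)"
    by (simp add: assms)
  also have "\<dots> = (\<beta> \<lhd> a') \<bullet> (b \<rhd> \<alpha>)"
    by (rule interchange_arr) (simp_all add: assms)
  finally show ?thesis .
qed

section \<open>Bijections induced by whiskering\<close>

text \<open>The inverse sends \<open>\<alpha> : G m \<rightarrow> F m\<close> to
  \<open>(\<alpha> n)(G \<eta>)\<close>. One round trip is trivial because \<open>F \<eta>\<close>
  is an identity; in the other, \<open>m \<theta> = \<eta> m\<close> produces a 2-cell past which
  \<alpha> can slide.\<close>

lemma whisker_right_bij:
  assumes "m \<in> hom1 K Q R" "n \<in> hom1 K R Q" "G \<in> hom1 K R D" "F \<in> hom1 K R D"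
    and "\<eta> \<in> hom2 K (id1 K R) (m \<cdot> n)" "\<theta> \<in> hom2 K (id1 K Q) (n \<cdot> m)"
    and mt: "m \<rhd> \<theta> = \<eta> \<lhd> m" and Fe: "F \<rhd> \<eta> = id2 K F"
  shows "bij_betw (\<lambda>\<alpha>. \<alpha> \<lhd> m) (hom2 K G F) (hom2 K (G \<cdot> m) (F \<cdot> m))"
proof (rule bij_betw_byWitness[where f' = "\<lambda>\<alpha>. (\<alpha> \<lhd> n) \<bullet> (G \<rhd> \<eta>)"])
  note [simp] = assms(1-6)[unfolded hom_def, simplified]
  have [simp]: "Q \<in> Obj (ucat K)" "R \<in> Obj (ucat K)"
    using arr1_obj[of m] assms(1) by (auto simp: hom_def)
  \<comment> \<open>An identity 2-cell has equal ends, so \<open>Fe\<close> forces this strict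
    equality, and the inverse map indeed lands in 2-cells to \<open>F\<close>.\<close>
  have FF [simp]: "F \<cdot> (m \<cdot> n) = F"
    using arg_cong[OF Fe, of "Cod (vcat K)"] by simp
  show "\<forall>\<alpha>\<in>hom2 K G F. ((\<alpha> \<lhd> m) \<lhd> n) \<bullet> (G \<rhd> \<eta>) = \<alpha>"
  proof
    fix \<alpha> assume "\<alpha> \<in> hom2 K G F"
    then have [simp]: "\<alpha> \<in> Arr (vcat K)" "Dom (vcat K) \<alpha> = G" "Cod (vcat K) \<alpha> = F"
      by (auto simp: hom_def)
    have "(F \<rhd> \<eta>) \<bullet> (\<alpha> \<lhd> id1 K R) = (\<alpha> \<lhd> (m \<cdot> n)) \<bullet> (G \<rhd> \<eta>)"
      by (rule whisker_exchange) simp_all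
    then show "((\<alpha> \<lhd> m) \<lhd> n) \<bullet> (G \<rhd> \<eta>) = \<alpha>"
      by (simp add: Fe)
  qed
  show "\<forall>\<alpha>\<in>hom2 K (G \<cdot> m) (F \<cdot> m). ((\<alpha> \<lhd> n) \<bullet> (G \<rhd> \<eta>)) \<lhd> m = \<alpha>"
  proof
    fix \<alpha> assume "\<alpha> \<in> hom2 K (G \<cdot> m) (F \<cdot> m)"
    then have [simp]: "\<alpha> \<in> Arr (vcat K)" "Dom (vcat K) \<alpha> = G \<cdot> m" "Cod (vcat K) \<alpha> = F \<cdot> m"
      by (auto simp: hom_def)
    have "((\<alpha> \<lhd> n) \<bullet> (G \<rhd> \<eta>)) \<lhd> m = (\<alpha> \<lhd> (n \<cdot> m)) \<bullet> (G \<rhd> (\<eta> \<lhd> m))"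
      by simp
    \<comment> \<open>Since \<alpha> lives between arrows out of \<open>Q\<close>, it can only be
      exchanged with a 2-cell between endo-arrows of \<open>Q\<close>; hence \<theta> replaces
      \<eta>.\<close>
    also have "\<dots> = (\<alpha> \<lhd> (n \<cdot> m)) \<bullet> ((G \<cdot> m) \<rhd> \<theta>)"
      by (simp flip: mt)
    also have "\<dots> = ((F \<cdot> m) \<rhd> \<theta>) \<bullet> (\<alpha> \<lhd> id1 K Q)"
      by (rule whisker_exchange[symmetric]) simp_all
    also have "(F \<cdot> m) \<rhd> \<theta> = (F \<rhd> \<eta>) \<lhd> m"
      by (simp flip: mt whisker_whisker)
    finally show "((\<alpha> \<lhd> n) \<bullet> (G \<rhd> \<eta>)) \<lhd> m = \<alpha>"
      by (simp add: Fe)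
  qed
  show "(\<lambda>\<alpha>. \<alpha> \<lhd> m) ` hom2 K G F \<subseteq> hom2 K (G \<cdot> m) (F \<cdot> m)"
    by (simp add: image_subset_iff hom_def)
  show "(\<lambda>\<alpha>. (\<alpha> \<lhd> n) \<bullet> (G \<rhd> \<eta>)) ` hom2 K (G \<cdot> m) (F \<cdot> m) \<subseteq> hom2 K G F"
    by (simp add: image_subset_iff hom_def)
qed

text \<open>\<open>\<delta>\<close> is the counit of an adjunction with left adjoint \<open>i\<close>, right adjoint \<open>d\<close> and identity unit.\<close>

lemma whisker_right_bij_coreflection:
  assumes "i \<in> hom1 K P Q" "d \<in> hom1 K Q P" "G \<in> hom1 K P D" "F \<in> hom1 K Q D"
    and "\<delta> \<in> hom2 K (i \<cdot> d) (id1 K Q)"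
    and di: "d \<cdot> i = id1 K P" and dd: "d \<rhd> \<delta> = id2 K d" and d_i: "\<delta> \<lhd> i = id2 K i"
  shows "bij_betw (\<lambda>\<alpha>. \<alpha> \<lhd> i) (hom2 K (G \<cdot> d) F) (hom2 K G (F \<cdot> i))"
\<comment> \<open>The two maps are transposition along the adjunction; each round trip is one
  triangle identity, \<open>dd\<close> or \<open>d_i\<close>.\<close>
proof (rule bij_betw_byWitness[where f' = "\<lambda>\<alpha>. (F \<rhd> \<delta>) \<bullet> (\<alpha> \<lhd> d)"])
  note [simp] = assms(1-5)[unfolded hom_def, simplified] di
  have [simp]: "Q \<in> Obj (ucat K)" "P \<in> Obj (ucat K)"
    using arr1_obj[of i] assms(1) by (auto simp: hom_def)
  show "\<forall>\<alpha>\<in>hom2 K (G \<cdot> d) F. (F \<rhd> \<delta>) \<bullet> ((\<alpha> \<lhd> i) \<lhd> d) = \<alpha>"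
  proof
    fix \<alpha> assume "\<alpha> \<in> hom2 K (G \<cdot> d) F"
    then have [simp]: "\<alpha> \<in> Arr (vcat K)" "Dom (vcat K) \<alpha> = G \<cdot> d" "Cod (vcat K) \<alpha> = F"
      by (auto simp: hom_def)
    have "(G \<cdot> d) \<rhd> \<delta> = id2 K (G \<cdot> d)"
      by (simp add: dd flip: whisker_whisker)
    moreover have "(F \<rhd> \<delta>) \<bullet> (\<alpha> \<lhd> (i \<cdot> d)) = (\<alpha> \<lhd> id1 K Q) \<bullet> ((G \<cdot> d) \<rhd> \<delta>)"
      by (rule whisker_exchange) simp_all
    ultimately show "(F \<rhd> \<delta>) \<bullet> ((\<alpha> \<lhd> i) \<lhd> d) = \<alpha>"
      by simp
  qed
  show "\<forall>\<alpha>\<in>hom2 K G (F \<cdot> i). ((F \<rhd> \<delta>) \<bullet> (\<alpha> \<lhd> d)) \<lhd> i = \<alpha>"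
    by (auto simp: hom_def d_i)
  show "(\<lambda>\<alpha>. \<alpha> \<lhd> i) ` hom2 K (G \<cdot> d) F \<subseteq> hom2 K G (F \<cdot> i)"
    by (simp add: image_subset_iff hom_def)
  show "(\<lambda>\<alpha>. (F \<rhd> \<delta>) \<bullet> (\<alpha> \<lhd> d)) ` hom2 K G (F \<cdot> i) \<subseteq> hom2 K (G \<cdot> d) F"
    by (simp add: image_subset_iff hom_def)
qed

section \<open>Kan extensions and the universal property of comma objects\<close>

lemma left_kan_iff:
  assumes "f \<in> hom1 K X Y" "g \<in> hom1 K X A"
  shows "left_kan K f g h \<psi> \<longleftrightarrow> h \<in> hom1 K Y A \<and> \<psi> \<in> hom2 K g (h \<cdot> f) \<and>
    (\<forall>k \<in> hom1 K Y A. bij_betw (\<lambda>\<chi>. (\<chi> \<lhd> f) \<bullet> \<psi>) (hom2 K h k) (hom2 K g (k \<cdot> f)))"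
  using assms unfolding left_kan_def hom_def by auto

text \<open>Keeping \<open>S\<close> arbitrary lets this lemma and the next three cover comma
  objects and isocomma objects alike.\<close>

lemma comma_wrt_square:
  assumes "comma_wrt S K f g p q \<phi>" "f \<in> hom1 K A C" "g \<in> hom1 K B C"
  obtains P where "p \<in> hom1 K P A" "q \<in> hom1 K P B" "\<phi> \<in> hom2 K (f \<cdot> p) (g \<cdot> q)" "\<phi> \<in> S"
  using assms unfolding comma_wrt_def lax_square_def hom_def by auto

lemma comma_wrt_arr:
  assumes "comma_wrt S K f g p q \<phi>" "p \<in> hom1 K P A" "f \<in> hom1 K A C" "g \<in> hom1 K B C"
    "u \<in> hom1 K X A" "v \<in> hom1 K X B" "\<alpha> \<in> hom2 K (f \<cdot> u) (g \<cdot> v)" "\<alpha> \<in> S"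
  obtains h where "h \<in> hom1 K X P" "p \<cdot> h = u" "q \<cdot> h = v" "\<phi> \<lhd> h = \<alpha>"
proof -
  have "lax_square K f g u v \<alpha> \<and> \<alpha> \<in> S"
    using assms unfolding lax_square_def by blast
  then have "\<exists>h. h \<in> hom1 K (dom1 K u) (dom1 K p) \<and> p \<cdot> h = u \<and> q \<cdot> h = v \<and> \<phi> \<lhd> h = \<alpha>"
    using assms(1) unfolding comma_wrt_def by blast
  moreover have "dom1 K u = X" "dom1 K p = P"
    using assms by (auto simp: hom_def)
  ultimately show ?thesis
    using that by auto
qed

lemma comma_wrt_cell:
  assumes "comma_wrt S K f g p q \<phi>" "p \<in> hom1 K P A" "h \<in> hom1 K X P" "k \<in> hom1 K X P"
    "\<alpha> \<in> hom2 K (p \<cdot> h) (p \<cdot> k)" "\<beta> \<in> hom2 K (q \<cdot> h) (q \<cdot> k)"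
    "(\<phi> \<lhd> k) \<bullet> (f \<rhd> \<alpha>) = (g \<rhd> \<beta>) \<bullet> (\<phi> \<lhd> h)"
  shows "\<exists>!\<gamma>. \<gamma> \<in> hom2 K h k \<and> p \<rhd> \<gamma> = \<alpha> \<and> q \<rhd> \<gamma> = \<beta>"
proof -
  have "dom1 K p = P"
    using assms by (auto simp: hom_def)
  then show ?thesis
    using assms unfolding comma_wrt_def by blast
qed

text \<open>For components that come from an actual 2-cell \<gamma>, compatibility with \<phi> is an
  instance of exchange. Hence \<gamma> and \<gamma>' are two fillers of the same data, and fillers
  are unique.\<close>

lemma comma_wrt_cell_eq:
  assumes comma: "comma_wrt S K f g p q \<phi>" and "h \<in> hom1 K X P"
    and p: "p \<in> hom1 K P A" "q \<in> hom1 K P B" "f \<in> hom1 K A C" "g \<in> hom1 K B C"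
    and "\<phi> \<in> hom2 K (f \<cdot> p) (g \<cdot> q)"
    and \<gamma>: "\<gamma> \<in> hom2 K h k" "\<gamma>' \<in> hom2 K h k" and eq: "p \<rhd> \<gamma> = p \<rhd> \<gamma>'" "q \<rhd> \<gamma> = q \<rhd> \<gamma>'"
  shows "\<gamma> = \<gamma>'"
proof -
  note [simp] = assms(2-9)[unfolded hom_def, simplified]
  have k: "k \<in> hom1 K X P"
    using arr2_simps[of \<gamma>] by (simp add: hom_def)
  note [simp] = k[unfolded hom_def, simplified]
  have "((g \<cdot> q) \<rhd> \<gamma>) \<bullet> (\<phi> \<lhd> h) = (\<phi> \<lhd> k) \<bullet> ((f \<cdot> p) \<rhd> \<gamma>)"
    by (rule whisker_exchange) simp_all
  then have "\<exists>!\<delta>. \<delta> \<in> hom2 K h k \<and> p \<rhd> \<delta> = p \<rhd> \<gamma> \<and> q \<rhd> \<delta> = q \<rhd> \<gamma>"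
    by (intro comma_wrt_cell[OF comma p(1) assms(2) k]) (simp_all add: hom_def)
  then show ?thesis
    using \<gamma> eq by metis
qed

text \<open>The square \<open>q 1 = 1 q\<close> induces \<open>i : P \<rightarrow> q\<down>1\<close>, which is left adjoint to the projection \<open>d\<close>.\<close>

lemma left_kan_of_comma_id:
  assumes comma: "is_comma K q (id1 K B) d e \<kappa>"
    and q: "q \<in> hom1 K P B" "G \<in> hom1 K P D" "L \<in> hom1 K B D" "\<Psi> \<in> hom2 K G (L \<cdot> q)"
    and kan: "left_kan K e (G \<cdot> d) L ((L \<rhd> \<kappa>) \<bullet> (\<Psi> \<lhd> d))"
  shows "left_kan K q G L \<Psi>"
proof -
  note comma = comma[unfolded is_comma_def]
  note [simp] = q[unfolded hom_def, simplified]
  have [simp]: "P \<in> Obj (ucat K)" "B \<in> Obj (ucat K)"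
    using arr1_obj[of q] by auto
  have idB: "id1 K B \<in> hom1 K B B"
    by (simp add: hom_def)
  obtain Q where Q: "d \<in> hom1 K Q P" "e \<in> hom1 K Q B" "\<kappa> \<in> hom2 K (q \<cdot> d) (id1 K B \<cdot> e)"
    by (rule comma_wrt_square[OF comma q(1) idB])
  note [simp] = Q[unfolded hom_def, simplified]
  have [simp]: "Q \<in> Obj (ucat K)"
    using arr1_obj[of d] by auto
  have [simp]: "Cod (vcat K) \<kappa> = e"
    by simp
  \<comment> \<open>\<open>i\<close> is classified by the identity 2-cell of \<open>q\<close>, so it
    is a section of \<open>d\<close> and \<kappa> restricts along it to an identity.\<close>
  obtain i where i: "i \<in> hom1 K P Q" "d \<cdot> i = id1 K P" "e \<cdot> i = q" "\<kappa> \<lhd> i = id2 K q"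
    by (rule comma_wrt_arr[OF comma Q(1) q(1) idB, of "id1 K P" P q "id2 K q"])
      (simp_all add: hom_def)
  note [simp] = i(2-4) i(1)[unfolded hom_def, simplified]
  have di [simp]: "d \<cdot> (i \<cdot> x) = x" "e \<cdot> (i \<cdot> x) = q \<cdot> x"
    if "x \<in> Arr (ucat K)" "cod1 K x = P" for x
    using that by (simp_all flip: comp1_assoc)
  have "\<kappa> \<lhd> (i \<cdot> d) = (\<kappa> \<lhd> i) \<lhd> d"
    by (simp del: i(4))
  then have [simp]: "\<kappa> \<lhd> (i \<cdot> d) = id2 K (q \<cdot> d)"
    by simp
  \<comment> \<open>The counit is the filler with components \<open>id2 K d\<close> and \<kappa>;
    the two are compatible because \<kappa> whiskered by \<open>i d\<close> is an identity.\<close>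
  have "\<exists>!\<delta>. \<delta> \<in> hom2 K (i \<cdot> d) (id1 K Q) \<and> d \<rhd> \<delta> = id2 K d \<and> e \<rhd> \<delta> = \<kappa>"
    by (rule comma_wrt_cell[OF comma Q(1), of _ Q])
      (simp_all add: hom_def)
  then obtain \<delta> where \<delta>: "\<delta> \<in> hom2 K (i \<cdot> d) (id1 K Q)" "d \<rhd> \<delta> = id2 K d" "e \<rhd> \<delta> = \<kappa>"
    by blast
  note [simp] = \<delta>(1)[unfolded hom_def, simplified]
  \<comment> \<open>The remaining triangle identity is tested after both projections, where it
    reduces to \<open>d i = 1\<close> and to \<open>\<kappa> i\<close> being an identity.\<close>
  have "\<delta> \<lhd> i = id2 K i"
  proof (rule comma_wrt_cell_eq[OF comma i(1) Q(1,2) q(1) idB Q(3)])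
    show "\<delta> \<lhd> i \<in> hom2 K i i" "id2 K i \<in> hom2 K i i"
      by (simp_all add: hom_def)
    show "d \<rhd> \<delta> \<lhd> i = d \<rhd> id2 K i" "e \<rhd> \<delta> \<lhd> i = e \<rhd> id2 K i"
      by (simp_all add: \<delta>(2,3) flip: hcomp_assoc_arr)
  qed
  note bij = whisker_right_bij_coreflection[OF i(1) Q(1) q(2) _ \<delta>(1) i(2) \<delta>(2) this]
  show ?thesis
    unfolding left_kan_iff[OF q(1,2)]
  proof (intro conjI ballI)
    fix k assume k: "k \<in> hom1 K B D"
    note [simp] = k[unfolded hom_def, simplified]
    have "bij_betw (\<lambda>\<chi>. (\<chi> \<lhd> e) \<bullet> ((L \<rhd> \<kappa>) \<bullet> (\<Psi> \<lhd> d))) (hom2 K L k) (hom2 K (G \<cdot> d) (k \<cdot> e))"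
      using kan k unfolding left_kan_def hom_def by auto
    moreover have "bij_betw (\<lambda>\<alpha>. \<alpha> \<lhd> i) (hom2 K (G \<cdot> d) (k \<cdot> e)) (hom2 K G (k \<cdot> q))"
      using bij[of "k \<cdot> e"] by (simp add: hom_def)
    ultimately have "bij_betw ((\<lambda>\<alpha>. \<alpha> \<lhd> i) \<circ> (\<lambda>\<chi>. (\<chi> \<lhd> e) \<bullet> ((L \<rhd> \<kappa>) \<bullet> (\<Psi> \<lhd> d))))
        (hom2 K L k) (hom2 K G (k \<cdot> q))"
      by (rule bij_betw_trans)
    \<comment> \<open>Restricting along \<open>i\<close> turns \<kappa> into an identity and cancels
      \<open>d\<close>, so the composite bijection is pasting with \<Psi>.\<close>
    moreover have "((\<lambda>\<alpha>. \<alpha> \<lhd> i) \<circ> (\<lambda>\<chi>. (\<chi> \<lhd> e) \<bullet> ((L \<rhd> \<kappa>) \<bullet> (\<Psi> \<lhd> d)))) \<chi> = (\<chi> \<lhd> q) \<bullet> \<Psi>"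
      if "\<chi> \<in> hom2 K L k" for \<chi>
      using that by (simp add: hom_def)
    ultimately show "bij_betw (\<lambda>\<chi>. (\<chi> \<lhd> q) \<bullet> \<Psi>) (hom2 K L k) (hom2 K G (k \<cdot> q))"
      by (rule bij_betw_cong[THEN iffD1, rotated])
  qed (use q in auto)
qed

section \<open>Comparison of comma objects and the exactness criterion\<close>

text \<open>Everything comes from applying \<open>lifts\<close> to the universal 2-cell \<mu>: the
  factor \<tau> induces \<open>n\<close>, \<rho> becomes a component of \<eta>, and the lifting
  property of \<tau> leads to \<theta>. The hypothesis \<open>cells\<close> is the existence half of
  the two-dimensional universal property of \<open>P\<close>.\<close>

lemma comma_comparison:
  assumes f: "f \<in> hom1 K A C" "g \<in> hom1 K B C" "p \<in> hom1 K P A" "q \<in> hom1 K P B"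
      "\<phi> \<in> hom2 K (f \<cdot> p) (g \<cdot> q)" "\<phi>' \<in> hom2 K (g \<cdot> q) (f \<cdot> p)"
    and inv: "\<phi>' \<bullet> \<phi> = id2 K (f \<cdot> p)" "\<phi> \<bullet> \<phi>' = id2 K (g \<cdot> q)"
    and cells: "\<And>X h k \<alpha> \<beta>. \<lbrakk>h \<in> hom1 K X P; k \<in> hom1 K X P; \<alpha> \<in> hom2 K (p \<cdot> h) (p \<cdot> k);
        \<beta> \<in> hom2 K (q \<cdot> h) (q \<cdot> k); (\<phi> \<lhd> k) \<bullet> (f \<rhd> \<alpha>) = (g \<rhd> \<beta>) \<bullet> (\<phi> \<lhd> h)\<rbrakk>
      \<Longrightarrow> \<exists>\<gamma> \<in> hom2 K h k. p \<rhd> \<gamma> = \<alpha> \<and> q \<rhd> \<gamma> = \<beta>"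
    and lifts: "\<And>X u v \<gamma>. \<lbrakk>u \<in> hom1 K X A; v \<in> hom1 K X B; \<gamma> \<in> hom2 K (f \<cdot> u) (g \<cdot> v)\<rbrakk>
      \<Longrightarrow> \<exists>t \<rho> \<tau>. t \<in> hom1 K X P \<and> \<rho> \<in> hom2 K u (p \<cdot> t) \<and> \<tau> \<in> hom2 K (q \<cdot> t) v \<and>
            (g \<rhd> \<tau>) \<bullet> ((\<phi> \<lhd> t) \<bullet> (f \<rhd> \<rho>)) = \<gamma> \<and> stably_lifting K g \<tau>"
    and k: "k \<in> hom1 K Z B" and commas: "is_comma K q k a b \<kappa>" "is_comma K f (g \<cdot> k) r s \<mu>"
  obtains m where "m \<in> hom1 K (dom1 K a) (dom1 K r)" "r \<cdot> m = p \<cdot> a" "s \<cdot> m = b"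
    "\<mu> \<lhd> m = (g \<rhd> \<kappa>) \<bullet> (\<phi> \<lhd> a)"
    "\<And>G F D. \<lbrakk>G \<in> hom1 K (dom1 K r) D; F \<in> hom1 K Z D\<rbrakk> \<Longrightarrow>
      bij_betw (\<lambda>\<alpha>. \<alpha> \<lhd> m) (hom2 K G (F \<cdot> s)) (hom2 K (G \<cdot> m) (F \<cdot> b))"
proof -
  note comma1 = commas(1)[unfolded is_comma_def] and comma2 = commas(2)[unfolded is_comma_def]
  note [simp] = f[unfolded hom_def, simplified] k[unfolded hom_def, simplified] inv
  have gk: "g \<cdot> k \<in> hom1 K Z C"
    by (simp add: hom_def)
  obtain Q where Q: "a \<in> hom1 K Q P" "b \<in> hom1 K Q Z" "\<kappa> \<in> hom2 K (q \<cdot> a) (k \<cdot> b)"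
    by (rule comma_wrt_square[OF comma1 f(4) k])
  obtain R where R: "r \<in> hom1 K R A" "s \<in> hom1 K R Z" "\<mu> \<in> hom2 K (f \<cdot> r) ((g \<cdot> k) \<cdot> s)"
    by (rule comma_wrt_square[OF comma2 f(1) gk])
  note [simp] = Q[unfolded hom_def, simplified] R[unfolded hom_def, simplified]
  have [simp]: "Q \<in> Obj (ucat K)" "R \<in> Obj (ucat K)"
    using arr1_obj[of a] arr1_obj[of r] by auto
  obtain m where m: "m \<in> hom1 K Q R" "r \<cdot> m = p \<cdot> a" "s \<cdot> m = b"
      "\<mu> \<lhd> m = (g \<rhd> \<kappa>) \<bullet> (\<phi> \<lhd> a)"
    by (rule comma_wrt_arr[OF comma2 R(1) f(1) gk, of "p \<cdot> a" Q b "(g \<rhd> \<kappa>) \<bullet> (\<phi> \<lhd> a)"])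
      (simp_all add: hom_def)
  note [simp] = m(2-4) m(1)[unfolded hom_def, simplified]
  obtain t \<rho> \<tau> where t: "t \<in> hom1 K R P" "\<rho> \<in> hom2 K r (p \<cdot> t)" "\<tau> \<in> hom2 K (q \<cdot> t) (k \<cdot> s)"
      "(g \<rhd> \<tau>) \<bullet> ((\<phi> \<lhd> t) \<bullet> (f \<rhd> \<rho>)) = \<mu>" and \<tau>: "stably_lifting K g \<tau>"
    using lifts[of r R "k \<cdot> s" \<mu>] by (auto simp: hom_def)
  note [simp] = t(1-3)[unfolded hom_def, simplified]
  \<comment> \<open>\<tau> is itself a square over \<open>q\<close> and \<open>k\<close>, so the
    comma object \<open>Q\<close> classifies it.\<close>
  obtain n where n: "n \<in> hom1 K R Q" "a \<cdot> n = t" "b \<cdot> n = s" "\<kappa> \<lhd> n = \<tau>"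
    by (rule comma_wrt_arr[OF comma1 Q(1) f(4) k, of t R s \<tau>]) (simp_all add: hom_def)
  note [simp] = n(2-4) n(1)[unfolded hom_def, simplified]
  have [simp]: "r \<cdot> (m \<cdot> x) = p \<cdot> (a \<cdot> x)" "s \<cdot> (m \<cdot> x) = b \<cdot> x"
    if "x \<in> Arr (ucat K)" "cod1 K x = Q" for x
    using that by (simp_all flip: comp1_assoc)
  have [simp]: "a \<cdot> (n \<cdot> x) = t \<cdot> x" "b \<cdot> (n \<cdot> x) = s \<cdot> x"
    if "x \<in> Arr (ucat K)" "cod1 K x = R" for x
    using that by (simp_all flip: comp1_assoc)
  \<comment> \<open>Restricting \<mu> along \<open>m n\<close> gives its factorisation with the
    factor \<rho> left out. This is why \<eta> can have \<rho> as its \<open>r\<close>-component and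
    an identity as its \<open>s\<close>-component.\<close>
  have mun: "\<mu> \<lhd> (m \<cdot> n) = (g \<rhd> \<tau>) \<bullet> (\<phi> \<lhd> t)"
  proof -
    have "\<mu> \<lhd> (m \<cdot> n) = (\<mu> \<lhd> m) \<lhd> n"
      by (simp del: m(4))
    then show ?thesis
      by simp
  qed
  have "\<exists>!\<eta>. \<eta> \<in> hom2 K (id1 K R) (m \<cdot> n) \<and> r \<rhd> \<eta> = \<rho> \<and> s \<rhd> \<eta> = id2 K s"
    by (rule comma_wrt_cell[OF comma2 R(1), of _ R])
      (simp_all add: hom_def mun t(4))
  then obtain \<eta> where \<eta>: "\<eta> \<in> hom2 K (id1 K R) (m \<cdot> n)" "r \<rhd> \<eta> = \<rho>" "s \<rhd> \<eta> = id2 K s"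
    by blast
  note [simp] = \<eta>(1)[unfolded hom_def, simplified]
  \<comment> \<open>\<chi> is the value forced on \<open>g \<omega>\<close> if the pair
    \<open>\<rho> m\<close>, \<omega> is to be compatible with \<phi>; solving for it uses the
    inverse \<phi>'.\<close>
  define \<chi> where "\<chi> = (\<phi> \<lhd> (t \<cdot> m)) \<bullet> ((f \<rhd> (\<rho> \<lhd> m)) \<bullet> (\<phi>' \<lhd> a))"
  have \<chi>: "\<chi> \<in> hom2 K (g \<cdot> (q \<cdot> a)) (g \<cdot> (q \<cdot> (t \<cdot> m)))"
    by (simp add: hom_def \<chi>_def)
  note [simp] = \<chi>[unfolded hom_def, simplified]
  have \<phi>inv: "(\<phi>' \<lhd> a) \<bullet> (\<phi> \<lhd> a) = id2 K (f \<cdot> (p \<cdot> a))" "(\<phi> \<lhd> a) \<bullet> (\<phi>' \<lhd> a) = id2 K (g \<cdot> (q \<cdot> a))"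
    by (simp_all flip: whisker_right_vcomp)
  have \<chi>\<phi>: "\<chi> \<bullet> (\<phi> \<lhd> a) = (\<phi> \<lhd> (t \<cdot> m)) \<bullet> (f \<rhd> (\<rho> \<lhd> m))"
    by (simp add: \<chi>_def \<phi>inv)
  have "(g \<rhd> (\<tau> \<lhd> m)) \<bullet> \<chi> = ((g \<rhd> \<tau>) \<bullet> ((\<phi> \<lhd> t) \<bullet> (f \<rhd> \<rho>))) \<lhd> m \<bullet> (\<phi>' \<lhd> a)"
    by (simp add: \<chi>_def)
  also have "\<dots> = g \<rhd> \<kappa>"
    by (simp add: t(4) \<phi>inv)
  \<comment> \<open>\<open>g \<kappa>\<close> factors through \<open>g (\<tau> m)\<close> via
    \<chi>, so \<kappa> factors through \<open>\<tau> m\<close> by a 2-cell over \<chi>. Stability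
    under precomposition is used at \<open>y = m\<close>.\<close>
  finally obtain \<omega> where \<omega>: "\<omega> \<in> hom2 K (q \<cdot> a) (q \<cdot> (t \<cdot> m))" "(\<tau> \<lhd> m) \<bullet> \<omega> = \<kappa>" "g \<rhd> \<omega> = \<chi>"
    using \<tau>[unfolded stably_lifting_def, rule_format, of m Q "q \<cdot> a" \<kappa> \<chi>] by (auto simp: hom_def)
  note [simp] = \<omega>(1)[unfolded hom_def, simplified]
  obtain \<sigma> where \<sigma>: "\<sigma> \<in> hom2 K a (t \<cdot> m)" "p \<rhd> \<sigma> = \<rho> \<lhd> m" "q \<rhd> \<sigma> = \<omega>"
    using cells[of a Q "t \<cdot> m" "\<rho> \<lhd> m" \<omega>] by (auto simp: hom_def \<omega>(3) \<chi>\<phi>)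
  note [simp] = \<sigma>(1)[unfolded hom_def, simplified]
  have kn: "\<kappa> \<lhd> (n \<cdot> m) = \<tau> \<lhd> m"
  proof -
    have "\<kappa> \<lhd> (n \<cdot> m) = (\<kappa> \<lhd> n) \<lhd> m"
      by (simp del: n(4))
    then show ?thesis
      by simp
  qed
  \<comment> \<open>The components \<sigma> and \<open>id2 K b\<close> are compatible with \<kappa>
    because \<open>\<kappa> n = \<tau>\<close> and
    \<open>(\<tau> m) \<omega> = \<kappa>\<close>.\<close>
  have "\<exists>!\<theta>. \<theta> \<in> hom2 K (id1 K Q) (n \<cdot> m) \<and> a \<rhd> \<theta> = \<sigma> \<and> b \<rhd> \<theta> = id2 K b"
    by (rule comma_wrt_cell[OF comma1 Q(1), of _ Q])
      (simp_all add: hom_def \<sigma>(3) \<omega>(2) kn)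
  then obtain \<theta> where \<theta>: "\<theta> \<in> hom2 K (id1 K Q) (n \<cdot> m)" "a \<rhd> \<theta> = \<sigma>" "b \<rhd> \<theta> = id2 K b"
    by blast
  note [simp] = \<theta>(1)[unfolded hom_def, simplified]
  \<comment> \<open>Projected by \<open>r\<close>, both sides are \<open>\<rho> m\<close>, which is
    what \<sigma> was built for; projected by \<open>s\<close>, both are identities.\<close>
  have m\<theta>: "m \<rhd> \<theta> = \<eta> \<lhd> m"
  proof (rule comma_wrt_cell_eq[OF comma2 m(1) R(1,2) f(1) gk R(3)])
    show "m \<rhd> \<theta> \<in> hom2 K m (m \<cdot> (n \<cdot> m))" "\<eta> \<lhd> m \<in> hom2 K m (m \<cdot> (n \<cdot> m))"
      by (simp_all add: hom_def)
    have "r \<rhd> (m \<rhd> \<theta>) = p \<rhd> (a \<rhd> \<theta>)" "s \<rhd> (m \<rhd> \<theta>) = b \<rhd> \<theta>"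
      by simp_all
    moreover have "r \<rhd> (\<eta> \<lhd> m) = (r \<rhd> \<eta>) \<lhd> m" "s \<rhd> (\<eta> \<lhd> m) = (s \<rhd> \<eta>) \<lhd> m"
      by simp_all
    ultimately show "r \<rhd> (m \<rhd> \<theta>) = r \<rhd> (\<eta> \<lhd> m)" "s \<rhd> (m \<rhd> \<theta>) = s \<rhd> (\<eta> \<lhd> m)"
      by (simp_all add: \<theta>(2,3) \<eta>(2,3) \<sigma>(2))
  qed
  show ?thesis
  proof (rule that)
    fix G F D assume G: "G \<in> hom1 K (dom1 K r) D" and F: "F \<in> hom1 K Z D"
    note [simp] = F[unfolded hom_def, simplified]
    have "(F \<cdot> s) \<rhd> \<eta> = F \<rhd> (s \<rhd> \<eta>)"
      by simp
    then have "(F \<cdot> s) \<rhd> \<eta> = id2 K (F \<cdot> s)"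
      by (simp only: \<eta>(3)) simp
    then have "bij_betw (\<lambda>\<alpha>. \<alpha> \<lhd> m) (hom2 K G (F \<cdot> s)) (hom2 K (G \<cdot> m) ((F \<cdot> s) \<cdot> m))"
      using G by (intro whisker_right_bij[OF m(1) n(1) _ _ \<eta>(1) \<theta>(1) m\<theta>]) (simp_all add: hom_def)
    then show "bij_betw (\<lambda>\<alpha>. \<alpha> \<lhd> m) (hom2 K G (F \<cdot> s)) (hom2 K (G \<cdot> m) (F \<cdot> b))"
      by simp
  qed (use m in simp_all)
qed

text \<open>For each \<open>k\<close>, pointwiseness of \<psi> gives a Kan extension on the comma
  object of \<open>f\<close> and \<open>g k\<close>. The comparison \<open>m\<close> transports it
  to the comma object of \<open>q\<close> and \<open>k\<close>, because whiskering with
  \<open>m\<close> is bijective on the 2-cells that occur in the universal property.\<close>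

theorem exact_of_lifts:
  assumes "has_commas K"
    and f: "f \<in> hom1 K A C" "g \<in> hom1 K B C" "p \<in> hom1 K P A" "q \<in> hom1 K P B"
      "\<phi> \<in> hom2 K (f \<cdot> p) (g \<cdot> q)" and iso: "\<phi> \<in> isos (vcat K)"
    and cells: "\<And>X h k \<alpha> \<beta>. \<lbrakk>h \<in> hom1 K X P; k \<in> hom1 K X P; \<alpha> \<in> hom2 K (p \<cdot> h) (p \<cdot> k);
        \<beta> \<in> hom2 K (q \<cdot> h) (q \<cdot> k); (\<phi> \<lhd> k) \<bullet> (f \<rhd> \<alpha>) = (g \<rhd> \<beta>) \<bullet> (\<phi> \<lhd> h)\<rbrakk>
      \<Longrightarrow> \<exists>\<gamma> \<in> hom2 K h k. p \<rhd> \<gamma> = \<alpha> \<and> q \<rhd> \<gamma> = \<beta>"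
    and lifts: "\<And>X u v \<gamma>. \<lbrakk>u \<in> hom1 K X A; v \<in> hom1 K X B; \<gamma> \<in> hom2 K (f \<cdot> u) (g \<cdot> v)\<rbrakk>
      \<Longrightarrow> \<exists>t \<rho> \<tau>. t \<in> hom1 K X P \<and> \<rho> \<in> hom2 K u (p \<cdot> t) \<and> \<tau> \<in> hom2 K (q \<cdot> t) v \<and>
            (g \<rhd> \<tau>) \<bullet> ((\<phi> \<lhd> t) \<bullet> (f \<rhd> \<rho>)) = \<gamma> \<and> stably_lifting K g \<tau>"
  shows "exact K f g p q \<phi>"
  unfolding exact_def
proof (intro conjI allI impI)
  show "lax_square K f g p q \<phi>"
    using f unfolding lax_square_def by blast
  note [simp] = f[unfolded hom_def, simplified]
  obtain \<phi>' where \<phi>': "\<phi>' \<in> hom2 K (g \<cdot> q) (f \<cdot> p)"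
      "\<phi>' \<bullet> \<phi> = id2 K (f \<cdot> p)" "\<phi> \<bullet> \<phi>' = id2 K (g \<cdot> q)"
    using iso by (auto simp: isos_def)
  fix h l \<psi> assume kan: "pointwise_left_kan K f h l \<psi>"
  then have "left_kan K f h l \<psi>"
    by (simp add: pointwise_left_kan_def)
  then obtain D where h: "h \<in> hom1 K A D" "l \<in> hom1 K C D" "\<psi> \<in> hom2 K h (l \<cdot> f)"
    unfolding left_kan_def by (auto simp: hom_def)
  note [simp] = h[unfolded hom_def, simplified]
  define \<Psi> where "\<Psi> = (l \<rhd> \<phi>) \<bullet> (\<psi> \<lhd> p)"
  have \<Psi>: "\<Psi> \<in> hom2 K (h \<cdot> p) ((l \<cdot> g) \<cdot> q)"
    by (simp add: \<Psi>_def hom_def)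
  have hp: "h \<cdot> p \<in> hom1 K P D" and lg: "l \<cdot> g \<in> hom1 K B D"
    by (simp_all add: hom_def)
  \<comment> \<open>This comes before the plain Kan property, which is then deduced from the
    instance where \<open>k\<close> is the identity of \<open>B\<close>.\<close>
  have pointwise: "left_kan K b ((h \<cdot> p) \<cdot> a) ((l \<cdot> g) \<cdot> k) (((l \<cdot> g) \<rhd> \<kappa>) \<bullet> (\<Psi> \<lhd> a))"
    if comma: "is_comma K q k a b \<kappa>" and k: "k \<in> hom1 K Z B" for k a b \<kappa> Z
  proof -
    note [simp] = k[unfolded hom_def, simplified]
    have gk: "g \<cdot> k \<in> hom1 K Z C"
      by (simp add: hom_def)
    obtain r s \<mu> where comma': "is_comma K f (g \<cdot> k) r s \<mu>"
      using \<open>has_commas K\<close> f(1) gk unfolding has_commas_def by blast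
    obtain Q where Q: "a \<in> hom1 K Q P" "b \<in> hom1 K Q Z" "\<kappa> \<in> hom2 K (q \<cdot> a) (k \<cdot> b)"
      by (rule comma_wrt_square[OF comma[unfolded is_comma_def] f(4) k])
    obtain R where R: "r \<in> hom1 K R A" "s \<in> hom1 K R Z" "\<mu> \<in> hom2 K (f \<cdot> r) ((g \<cdot> k) \<cdot> s)"
      by (rule comma_wrt_square[OF comma'[unfolded is_comma_def] f(1) gk])
    note [simp] = Q[unfolded hom_def, simplified] R[unfolded hom_def, simplified]
    obtain m where m: "m \<in> hom1 K (dom1 K a) (dom1 K r)" "r \<cdot> m = p \<cdot> a" "s \<cdot> m = b"
        "\<mu> \<lhd> m = (g \<rhd> \<kappa>) \<bullet> (\<phi> \<lhd> a)"
      and bij: "\<And>G F D. \<lbrakk>G \<in> hom1 K (dom1 K r) D; F \<in> hom1 K Z D\<rbrakk> \<Longrightarrow>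
        bij_betw (\<lambda>\<alpha>. \<alpha> \<lhd> m) (hom2 K G (F \<cdot> s)) (hom2 K (G \<cdot> m) (F \<cdot> b))"
      by (rule comma_comparison[OF f \<phi>' cells lifts k comma comma']; blast)
    note [simp] = m(2-4) m(1)[unfolded hom_def, simplified]
    have hr: "h \<cdot> r \<in> hom1 K R D"
      by (simp add: hom_def)
    have kan': "left_kan K s (h \<cdot> r) (l \<cdot> (g \<cdot> k)) ((l \<rhd> \<mu>) \<bullet> (\<psi> \<lhd> r))"
      using kan comma' by (simp add: pointwise_left_kan_def)
    have hpa: "(h \<cdot> p) \<cdot> a \<in> hom1 K Q D"
      by (simp add: hom_def)
    show ?thesis
      unfolding left_kan_iff[OF Q(2) hpa]
    proof (intro conjI ballI)
      show "(l \<cdot> g) \<cdot> k \<in> hom1 K Z D"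
        "((l \<cdot> g) \<rhd> \<kappa>) \<bullet> (\<Psi> \<lhd> a) \<in> hom2 K ((h \<cdot> p) \<cdot> a) (((l \<cdot> g) \<cdot> k) \<cdot> b)"
        using \<Psi> by (simp_all add: hom_def)
      fix k' assume k': "k' \<in> hom1 K Z D"
      note [simp] = k'[unfolded hom_def, simplified]
      have "bij_betw (\<lambda>\<chi>. (\<chi> \<lhd> s) \<bullet> ((l \<rhd> \<mu>) \<bullet> (\<psi> \<lhd> r)))
          (hom2 K (l \<cdot> (g \<cdot> k)) k') (hom2 K (h \<cdot> r) (k' \<cdot> s))"
        using kan' k' unfolding left_kan_iff[OF R(2) hr] by blast
      moreover have "bij_betw (\<lambda>\<alpha>. \<alpha> \<lhd> m) (hom2 K (h \<cdot> r) (k' \<cdot> s)) (hom2 K (h \<cdot> (p \<cdot> a)) (k' \<cdot> b))"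
        using bij[of "h \<cdot> r" D k'] by (simp add: hom_def)
      ultimately have "bij_betw ((\<lambda>\<alpha>. \<alpha> \<lhd> m) \<circ> (\<lambda>\<chi>. (\<chi> \<lhd> s) \<bullet> ((l \<rhd> \<mu>) \<bullet> (\<psi> \<lhd> r))))
          (hom2 K (l \<cdot> (g \<cdot> k)) k') (hom2 K (h \<cdot> (p \<cdot> a)) (k' \<cdot> b))"
        by (rule bij_betw_trans)
      \<comment> \<open>\<open>\<mu> m\<close> is the pasting of \<kappa> and \<phi>, so whiskering
        the pasted 2-cell by \<open>m\<close> yields the one required over \<open>q\<close> and
        \<open>k\<close>.\<close>
      moreover have "((\<lambda>\<alpha>. \<alpha> \<lhd> m) \<circ> (\<lambda>\<chi>. (\<chi> \<lhd> s) \<bullet> ((l \<rhd> \<mu>) \<bullet> (\<psi> \<lhd> r)))) \<chi>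
          = (\<chi> \<lhd> b) \<bullet> (((l \<cdot> g) \<rhd> \<kappa>) \<bullet> (\<Psi> \<lhd> a))"
        if "\<chi> \<in> hom2 K (l \<cdot> (g \<cdot> k)) k'" for \<chi>
        using that by (simp add: hom_def \<Psi>_def)
      ultimately have "bij_betw (\<lambda>\<chi>. (\<chi> \<lhd> b) \<bullet> (((l \<cdot> g) \<rhd> \<kappa>) \<bullet> (\<Psi> \<lhd> a)))
          (hom2 K (l \<cdot> (g \<cdot> k)) k') (hom2 K (h \<cdot> (p \<cdot> a)) (k' \<cdot> b))"
        by (rule bij_betw_cong[THEN iffD1, rotated])
      then show "bij_betw (\<lambda>\<chi>. (\<chi> \<lhd> b) \<bullet> (((l \<cdot> g) \<rhd> \<kappa>) \<bullet> (\<Psi> \<lhd> a)))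
          (hom2 K ((l \<cdot> g) \<cdot> k) k') (hom2 K ((h \<cdot> p) \<cdot> a) (k' \<cdot> b))"
        by simp
    qed
  qed
  have "left_kan K q (h \<cdot> p) (l \<cdot> g) \<Psi>"
  proof -
    have "B \<in> Obj (ucat K)"
      using arr1_obj[of q] by simp
    then have idB: "id1 K B \<in> hom1 K B B"
      by (simp add: hom_def)
    obtain d e \<kappa> where comma: "is_comma K q (id1 K B) d e \<kappa>"
      using \<open>has_commas K\<close> f(4) idB unfolding has_commas_def by blast
    have "(l \<cdot> g) \<cdot> id1 K B = l \<cdot> g"
      by (rule comp1_id) simp_all
    then show ?thesis
      using pointwise[OF comma idB] by (intro left_kan_of_comma_id[OF comma f(4) hp lg \<Psi>]) simp
  qed
  \<comment> \<open>\<open>pointwise_left_kan\<close> quantifies over untyped \<open>k\<close>; the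
    comma square itself forces the codomain \<open>B\<close>.\<close>
  moreover have "\<exists>Z. k \<in> hom1 K Z B" if "is_comma K q k a b \<kappa>" for k a b \<kappa>
    using that f(4) unfolding is_comma_def comma_wrt_def lax_square_def by (auto simp: hom_def)
  ultimately show "pointwise_left_kan K q (h \<cdot> p) (l \<cdot> g) ((l \<rhd> \<phi>) \<bullet> (\<psi> \<lhd> p))"
    unfolding pointwise_left_kan_def \<Psi>_def[symmetric] using pointwise by blast
qed

section \<open>Cartesian 2-cells, lifts and stable lifting\<close>

lemma hom_hom_cat: "hom (hom_cat K X Y) a b = (if a \<in> hom1 K X Y then hom2 K a b else {})"
  by (auto simp: hom_cat_def hom_def)

lemma hom_cat_simps:
  "Obj (hom_cat K X Y) = hom1 K X Y" "Dom (hom_cat K X Y) = Dom (vcat K)"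
  "Cod (hom_cat K X Y) = Cod (vcat K)" "Comp (hom_cat K X Y) = Comp (vcat K)"
  by (simp_all add: hom_cat_def)

lemma isos_obtain:
  assumes "\<alpha> \<in> isos (vcat K)" "\<alpha> \<in> hom2 K a b"
  obtains \<alpha>' where "\<alpha>' \<in> isos (vcat K)" "\<alpha>' \<in> hom2 K b a" "\<alpha>' \<bullet> \<alpha> = id2 K a" "\<alpha> \<bullet> \<alpha>' = id2 K b"
  using assms by (auto simp: isos_def hom_def)

lemma isosI:
  assumes "\<alpha> \<in> hom2 K a b" "\<alpha>' \<in> hom2 K b a" "\<alpha>' \<bullet> \<alpha> = id2 K a" "\<alpha> \<bullet> \<alpha>' = id2 K b"
  shows "\<alpha> \<in> isos (vcat K)"
  using assms by (auto simp: isos_def hom_def)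

lemma isos_hom_catD:
  assumes "\<alpha> \<in> isos (hom_cat K X Y)"
  shows "\<alpha> \<in> isos (vcat K)"
  using assms by (auto simp: isos_def hom_def hom_cat_def)

lemma isos_whisker_left:
  assumes "\<alpha> \<in> isos (vcat K)" "g \<in> Arr (ucat K)" "dom1 K g = cod1 K (Dom (vcat K) \<alpha>)"
  shows "g \<rhd> \<alpha> \<in> isos (vcat K)"
proof -
  obtain \<alpha>' where "\<alpha>' \<in> hom2 K (Cod (vcat K) \<alpha>) (Dom (vcat K) \<alpha>)"
      "\<alpha>' \<bullet> \<alpha> = id2 K (Dom (vcat K) \<alpha>)" "\<alpha> \<bullet> \<alpha>' = id2 K (Cod (vcat K) \<alpha>)"
    by (rule isos_obtain[OF assms(1)]) (use assms in \<open>auto simp: hom_def isos_def\<close>)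
  moreover have "\<alpha> \<in> Arr (vcat K)"
    using assms by (simp add: isos_def)
  ultimately show ?thesis
    using assms(2,3)
    by (intro isosI[of _ "g \<cdot> Dom (vcat K) \<alpha>" "g \<cdot> Cod (vcat K) \<alpha>" "g \<rhd> \<alpha>'"])
      (simp_all add: hom_def flip: whisker_left_vcomp)
qed

lemma isos_whisker_right:
  assumes "\<alpha> \<in> isos (vcat K)" "f \<in> Arr (ucat K)" "cod1 K f = dom1 K (Dom (vcat K) \<alpha>)"
  shows "\<alpha> \<lhd> f \<in> isos (vcat K)"
proof -
  obtain \<alpha>' where "\<alpha>' \<in> hom2 K (Cod (vcat K) \<alpha>) (Dom (vcat K) \<alpha>)"
      "\<alpha>' \<bullet> \<alpha> = id2 K (Dom (vcat K) \<alpha>)" "\<alpha> \<bullet> \<alpha>' = id2 K (Cod (vcat K) \<alpha>)"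
    by (rule isos_obtain[OF assms(1)]) (use assms in \<open>auto simp: hom_def isos_def\<close>)
  moreover have "\<alpha> \<in> Arr (vcat K)"
    using assms by (simp add: isos_def)
  ultimately show ?thesis
    using assms(2,3)
    by (intro isosI[of _ "Dom (vcat K) \<alpha> \<cdot> f" "Cod (vcat K) \<alpha> \<cdot> f" "\<alpha>' \<lhd> f"])
      (simp_all add: hom_def flip: whisker_right_vcomp)
qed

lemma isos_id2: "f \<in> Arr (ucat K) \<Longrightarrow> id2 K f \<in> isos (vcat K)"
  by (rule isosI[of _ f f "id2 K f"]) (simp_all add: hom_def)

lemma stably_lifting_id2:
  assumes "g \<in> hom1 K B C" "v \<in> hom1 K X B"
  shows "stably_lifting K g (id2 K v)"
  using assms unfolding stably_lifting_def by (auto simp: hom_def)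

text \<open>Push \<chi> forward along \<open>\<iota> y\<close>, solve the lifting problem for
  \<beta>, and compose the solution with the inverse of \<open>\<iota> y\<close>. Taking \<beta> to
  be an identity shows that invertible 2-cells are stably lifting.\<close>

lemma stably_lifting_vcomp_iso:
  assumes "g \<in> hom1 K B C" "a \<in> hom1 K X B" "\<iota> \<in> hom2 K a b" "\<beta> \<in> hom2 K b c"
    and iso: "\<iota> \<in> isos (vcat K)" and \<beta>: "stably_lifting K g \<beta>"
  shows "stably_lifting K g (\<beta> \<bullet> \<iota>)"
  unfolding stably_lifting_def
proof (intro allI ballI impI)
  note [simp] = assms(1-4)[unfolded hom_def, simplified]
  have b: "b \<in> hom1 K X B"
    using arr2_simps[of \<iota>] by (simp add: hom_def)
  have c: "c \<in> hom1 K X B"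
    using arr2_simps[of \<beta>] b by (simp add: hom_def)
  note [simp] = b[unfolded hom_def, simplified] c[unfolded hom_def, simplified]
  obtain \<iota>' where \<iota>': "\<iota>' \<in> hom2 K b a" "\<iota>' \<bullet> \<iota> = id2 K a" "\<iota> \<bullet> \<iota>' = id2 K b"
    using isos_obtain[OF iso assms(3)] by blast
  note [simp] = \<iota>'(1)[unfolded hom_def, simplified]
  fix Y y w \<xi> \<chi>
  assume "y \<in> hom1 K Y (dom1 K (Dom (vcat K) (\<beta> \<bullet> \<iota>)))"
    "w \<in> hom1 K Y (cod1 K (Dom (vcat K) (\<beta> \<bullet> \<iota>)))"
    "\<xi> \<in> hom2 K w (Cod (vcat K) (\<beta> \<bullet> \<iota>) \<cdot> y)"
    "\<chi> \<in> hom2 K (g \<cdot> w) (g \<cdot> (Dom (vcat K) (\<beta> \<bullet> \<iota>) \<cdot> y))"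
    and eq: "g \<rhd> (\<beta> \<bullet> \<iota>) \<lhd> y \<bullet> \<chi> = g \<rhd> \<xi>"
  then have y: "y \<in> hom1 K Y X" "w \<in> hom1 K Y B" "\<xi> \<in> hom2 K w (c \<cdot> y)"
      "\<chi> \<in> hom2 K (g \<cdot> w) (g \<cdot> (a \<cdot> y))"
    by simp_all
  note [simp] = y[unfolded hom_def, simplified]
  have 1: "(\<iota>' \<lhd> y) \<bullet> (\<iota> \<lhd> y) = id2 K (a \<cdot> y)" "(\<iota> \<lhd> y) \<bullet> (\<iota>' \<lhd> y) = id2 K (b \<cdot> y)"
    by (simp_all add: \<iota>' flip: whisker_right_vcomp)
  have "\<exists>\<omega> \<in> hom2 K w (b \<cdot> y). (\<beta> \<lhd> y) \<bullet> \<omega> = \<xi> \<and> g \<rhd> \<omega> = (g \<rhd> (\<iota> \<lhd> y)) \<bullet> \<chi>"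
    using \<beta>[unfolded stably_lifting_def, rule_format, of y Y w \<xi> "(g \<rhd> (\<iota> \<lhd> y)) \<bullet> \<chi>"] eq
    by (simp add: hom_def)
  then obtain \<omega> where \<omega>: "\<omega> \<in> hom2 K w (b \<cdot> y)" "(\<beta> \<lhd> y) \<bullet> \<omega> = \<xi>"
      "g \<rhd> \<omega> = (g \<rhd> (\<iota> \<lhd> y)) \<bullet> \<chi>"
    by blast
  note [simp] = \<omega>(1)[unfolded hom_def, simplified]
  have "((\<beta> \<bullet> \<iota>) \<lhd> y) \<bullet> ((\<iota>' \<lhd> y) \<bullet> \<omega>) = (\<beta> \<lhd> y) \<bullet> (((\<iota> \<lhd> y) \<bullet> (\<iota>' \<lhd> y)) \<bullet> \<omega>)"
    by simp
  also have "\<dots> = \<xi>"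
    by (simp only: 1) (simp add: \<omega>)
  finally have 2: "((\<beta> \<bullet> \<iota>) \<lhd> y) \<bullet> ((\<iota>' \<lhd> y) \<bullet> \<omega>) = \<xi>" .
  have "g \<rhd> ((\<iota>' \<lhd> y) \<bullet> \<omega>) = (g \<rhd> ((\<iota>' \<lhd> y) \<bullet> (\<iota> \<lhd> y))) \<bullet> \<chi>"
    by (simp add: \<omega>(3))
  also have "\<dots> = \<chi>"
    by (simp only: 1) simp
  finally show "\<exists>\<omega>\<in>hom2 K w (Dom (vcat K) (\<beta> \<bullet> \<iota>) \<cdot> y).
      (\<beta> \<bullet> \<iota>) \<lhd> y \<bullet> \<omega> = \<xi> \<and> g \<rhd> \<omega> = \<chi>"
    using 2 by (intro bexI[of _ "(\<iota>' \<lhd> y) \<bullet> \<omega>"]) (simp_all add: hom_def)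
qed

text \<open>Preservation under precomposition makes \<open>\<beta> y\<close> cartesian for every
  \<open>y\<close>, and the existence half of its universal property is the required
  factorisation.\<close>

lemma stably_lifting_cartesian:
  assumes "g \<in> hom1 K B C" "v \<in> hom1 K X B" "\<beta> \<in> hom2 K v v'" and "pre_preserves_cartesian K g"
    and cart: "cartesian (hom_cat K X B) (hom_cat K X C) (post K g) \<beta>"
  shows "stably_lifting K g \<beta>"
  unfolding stably_lifting_def
proof (intro allI ballI impI)
  note [simp] = assms(1-3)[unfolded hom_def, simplified]
  have v': "v' \<in> hom1 K X B"
    using arr2_simps[of \<beta>] by (simp add: hom_def)
  note [simp] = v'[unfolded hom_def, simplified]
  fix Y y w \<xi> \<chi>
  assume "y \<in> hom1 K Y (dom1 K (Dom (vcat K) \<beta>))" "w \<in> hom1 K Y (cod1 K (Dom (vcat K) \<beta>))"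
    "\<xi> \<in> hom2 K w (Cod (vcat K) \<beta> \<cdot> y)" "\<chi> \<in> hom2 K (g \<cdot> w) (g \<cdot> (Dom (vcat K) \<beta> \<cdot> y))"
    and eq: "(g \<rhd> (\<beta> \<lhd> y)) \<bullet> \<chi> = g \<rhd> \<xi>"
  then have y: "y \<in> hom1 K Y X" "w \<in> hom1 K Y B" "\<xi> \<in> hom2 K w (v' \<cdot> y)"
      "\<chi> \<in> hom2 K (g \<cdot> w) (g \<cdot> (v \<cdot> y))"
    by simp_all
  note [simp] = y[unfolded hom_def, simplified]
  have "cartesian (hom_cat K Y B) (hom_cat K Y C) (post K g) (\<beta> \<lhd> y)"
    using assms(4)[unfolded pre_preserves_cartesian_def, rule_format, of y Y X \<beta>] cart y(1)
    by (simp add: pre_def)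
  then have "\<exists>!\<omega>. \<omega> \<in> hom2 K w (v \<cdot> y) \<and> (\<beta> \<lhd> y) \<bullet> \<omega> = \<xi> \<and> g \<rhd> \<omega> = \<chi>"
    unfolding cartesian_def using y eq
    by (elim conjE ballE[where x = w] ballE[where x = \<xi>] ballE[where x = \<chi>])
      (simp_all add: hom_hom_cat hom_cat_simps post_def, simp_all add: hom_def)
  then show "\<exists>\<omega>\<in>hom2 K w (Dom (vcat K) \<beta> \<cdot> y). (\<beta> \<lhd> y) \<bullet> \<omega> = \<xi> \<and> g \<rhd> \<omega> = \<chi>"
    by auto
qed

lemma fibration_lift:
  assumes "fibration K g" "g \<in> hom1 K B C" "c \<in> hom1 K X C" "v \<in> hom1 K X B" "\<gamma> \<in> hom2 K c (g \<cdot> v)"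
  obtains v' \<beta> where "v' \<in> hom1 K X B" "\<beta> \<in> hom2 K v' v" "g \<cdot> v' = c" "g \<rhd> \<beta> = \<gamma>"
    "stably_lifting K g \<beta>"
proof -
  have g: "dom1 K g = B" "cod1 K g = C" and X: "X \<in> Obj (ucat K)"
    using assms arr1_obj[of v] by (auto simp: hom_def)
  then have fib: "grothendieck_fibration (hom_cat K X B) (hom_cat K X C) (post K g)"
      and pre: "pre_preserves_cartesian K g"
    using assms(1) by (auto simp: fibration_def)
  have \<gamma>: "\<gamma> \<in> hom (hom_cat K X C) c (on_obj (post K g) v)" and v: "v \<in> Obj (hom_cat K X B)"
    using assms by (simp_all add: hom_hom_cat hom_cat_simps post_def)
  obtain v' \<beta> where "v' \<in> Obj (hom_cat K X B)" "\<beta> \<in> hom (hom_cat K X B) v' v"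
      "cartesian (hom_cat K X B) (hom_cat K X C) (post K g) \<beta>"
      "on_obj (post K g) v' = c" "on_arr (post K g) \<beta> = \<gamma>"
    using fib[unfolded grothendieck_fibration_def, THEN conjunct2, rule_format, OF v \<gamma>] by blast
  then show ?thesis
    using stably_lifting_cartesian[OF assms(2) _ _ pre, of v' X \<beta> v]
    by (intro that[of v' \<beta>]) (simp_all add: hom_hom_cat hom_cat_simps post_def)
qed

lemma bi_fibration_lift:
  assumes "bi_fibration K g" "g \<in> hom1 K B C" "c \<in> hom1 K X C" "v \<in> hom1 K X B" "\<gamma> \<in> hom2 K c (g \<cdot> v)"
  obtains v' \<beta> \<theta> where "v' \<in> hom1 K X B" "\<beta> \<in> hom2 K v' v" "\<theta> \<in> hom2 K c (g \<cdot> v')"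
    "\<theta> \<in> isos (vcat K)" "(g \<rhd> \<beta>) \<bullet> \<theta> = \<gamma>" "stably_lifting K g \<beta>"
proof -
  have g: "dom1 K g = B" "cod1 K g = C" and X: "X \<in> Obj (ucat K)"
    using assms arr1_obj[of v] by (auto simp: hom_def)
  then have fib: "weak_grothendieck_fibration (hom_cat K X B) (hom_cat K X C) (post K g)"
      and pre: "pre_preserves_cartesian K g"
    using assms(1) by (auto simp: bi_fibration_def)
  have \<gamma>: "\<gamma> \<in> hom (hom_cat K X C) c (on_obj (post K g) v)" and v: "v \<in> Obj (hom_cat K X B)"
    using assms by (simp_all add: hom_hom_cat hom_cat_simps post_def)
  obtain v' \<beta> \<theta> where "v' \<in> Obj (hom_cat K X B)" "\<beta> \<in> hom (hom_cat K X B) v' v"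
      "\<theta> \<in> hom (hom_cat K X C) c (on_obj (post K g) v')" "\<theta> \<in> isos (hom_cat K X C)"
      "cartesian (hom_cat K X B) (hom_cat K X C) (post K g) \<beta>"
      "Comp (hom_cat K X C) (on_arr (post K g) \<beta>) \<theta> = \<gamma>"
    using fib[unfolded weak_grothendieck_fibration_def, THEN conjunct2, rule_format, OF v \<gamma>] by blast
  then show ?thesis
    using stably_lifting_cartesian[OF assms(2) _ _ pre, of v' X \<beta> v] isos_hom_catD[of \<theta> X C] assms(3)
    by (intro that[of v' \<beta> \<theta>]) (simp_all add: hom_hom_cat hom_cat_simps post_def)
qed

text \<open>In \<open>co_dual K\<close> the cartesian lift of \<gamma> is a 2-cell out of
  \<open>u\<close>. The lift is what gets extracted, since in this case the stable lifting of \<tau>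
  will come from invertibility.\<close>

lemma opfibration_lift:
  assumes "opfibration K f" "f \<in> hom1 K A C" "c \<in> hom1 K X C" "u \<in> hom1 K X A" "\<gamma> \<in> hom2 K (f \<cdot> u) c"
  obtains u' \<alpha> where "u' \<in> hom1 K X A" "\<alpha> \<in> hom2 K u u'" "f \<cdot> u' = c" "f \<rhd> \<alpha> = \<gamma>"
proof -
  let ?K = "co_dual K"
  have f: "dom1 K f = A" "cod1 K f = C" and X: "X \<in> Obj (ucat K)"
    using assms arr1_obj[of u] by (auto simp: hom_def)
  then have fib: "grothendieck_fibration (hom_cat ?K X A) (hom_cat ?K X C) (post ?K f)"
    using assms(1) by (auto simp: opfibration_def fibration_def co_dual_def)
  have u: "u \<in> Obj (hom_cat ?K X A)" and \<gamma>: "\<gamma> \<in> hom (hom_cat ?K X C) c (on_obj (post ?K f) u)"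
    using assms by (auto simp: hom_def post_def hom_cat_def co_dual_def op_cat_def)
  show ?thesis
    using fib[unfolded grothendieck_fibration_def, THEN conjunct2, rule_format, OF u \<gamma>] that
    by (auto simp: hom_def post_def hom_cat_def co_dual_def op_cat_def)
qed

lemma bi_opfibration_lift:
  assumes "bi_opfibration K f" "f \<in> hom1 K A C" "c \<in> hom1 K X C" "u \<in> hom1 K X A" "\<gamma> \<in> hom2 K (f \<cdot> u) c"
  obtains u' \<alpha> \<theta> where "u' \<in> hom1 K X A" "\<alpha> \<in> hom2 K u u'" "\<theta> \<in> hom2 K (f \<cdot> u') c"
    "\<theta> \<in> isos (vcat K)" "\<theta> \<bullet> (f \<rhd> \<alpha>) = \<gamma>"
proof -
  let ?K = "co_dual K"
  have f: "dom1 K f = A" "cod1 K f = C" and X: "X \<in> Obj (ucat K)"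
    using assms arr1_obj[of u] by (auto simp: hom_def)
  then have fib: "weak_grothendieck_fibration (hom_cat ?K X A) (hom_cat ?K X C) (post ?K f)"
    using assms(1) by (auto simp: bi_opfibration_def bi_fibration_def co_dual_def)
  have u: "u \<in> Obj (hom_cat ?K X A)" and \<gamma>: "\<gamma> \<in> hom (hom_cat ?K X C) c (on_obj (post ?K f) u)"
    using assms by (auto simp: hom_def post_def hom_cat_def co_dual_def op_cat_def)
  \<comment> \<open>Invertibility does not see the direction of 2-cells, so it passes from the dual
    hom-category back to \<open>K\<close>.\<close>
  have "\<theta> \<in> isos (vcat K)" if "\<theta> \<in> isos (hom_cat ?K X C)" for \<theta>
    using that by (auto simp: isos_def hom_def hom_cat_def co_dual_def op_cat_def)
  then show ?thesis
    using fib[unfolded weak_grothendieck_fibration_def, THEN conjunct2, rule_format, OF u \<gamma>] that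
    by (auto simp: hom_def post_def hom_cat_def co_dual_def op_cat_def)
qed

section \<open>Exactness of pullback squares\<close>

theorem exact_pullback:
  assumes "has_commas K" and pb: "is_pullback K f g p q" and fib: "opfibration K f \<or> fibration K g"
  shows "exact K f g p q (id2 K (f \<cdot> p))"
proof -
  obtain P A B C where f: "p \<in> hom1 K P A" "q \<in> hom1 K P B" "f \<in> hom1 K A C" "g \<in> hom1 K B C"
      "f \<cdot> p = g \<cdot> q"
    and arr: "\<forall>X. \<forall>u \<in> hom1 K X A. \<forall>v \<in> hom1 K X B. f \<cdot> u = g \<cdot> v \<longrightarrow>
      (\<exists>!h. h \<in> hom1 K X P \<and> p \<cdot> h = u \<and> q \<cdot> h = v)"
    and cell: "\<forall>X. \<forall>h \<in> hom1 K X P. \<forall>k \<in> hom1 K X P. \<forall>\<alpha> \<in> hom2 K (p \<cdot> h) (p \<cdot> k).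
      \<forall>\<beta> \<in> hom2 K (q \<cdot> h) (q \<cdot> k). f \<rhd> \<alpha> = g \<rhd> \<beta> \<longrightarrow>
      (\<exists>!\<gamma>. \<gamma> \<in> hom2 K h k \<and> p \<rhd> \<gamma> = \<alpha> \<and> q \<rhd> \<gamma> = \<beta>)"
    using pb unfolding is_pullback_def by (elim exE conjE)
  note [simp] = f[unfolded hom_def, simplified]
  have [simp]: "f \<cdot> (p \<cdot> x) = g \<cdot> (q \<cdot> x)" if "x \<in> Arr (ucat K)" "cod1 K x = P" for x
    using that by (simp flip: comp1_assoc)
  show ?thesis
  proof (rule exact_of_lifts[OF assms(1) f(3,4,1,2)])
    show "id2 K (f \<cdot> p) \<in> hom2 K (f \<cdot> p) (g \<cdot> q)" "id2 K (f \<cdot> p) \<in> isos (vcat K)"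
      by (simp_all add: hom_def isos_id2)
  next
    fix X h k \<alpha> \<beta>
    assume h: "h \<in> hom1 K X P" "k \<in> hom1 K X P" "\<alpha> \<in> hom2 K (p \<cdot> h) (p \<cdot> k)"
      "\<beta> \<in> hom2 K (q \<cdot> h) (q \<cdot> k)"
      "(id2 K (f \<cdot> p) \<lhd> k) \<bullet> (f \<rhd> \<alpha>) = (g \<rhd> \<beta>) \<bullet> (id2 K (f \<cdot> p) \<lhd> h)"
    \<comment> \<open>The 2-cell of the square is an identity, so compatibility reduces to agreement
      over \<open>C\<close>.\<close>
    then have "f \<rhd> \<alpha> = g \<rhd> \<beta>"
      by (simp add: hom_def)
    then show "\<exists>\<gamma> \<in> hom2 K h k. p \<rhd> \<gamma> = \<alpha> \<and> q \<rhd> \<gamma> = \<beta>"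
      using cell[rule_format, of h X k \<alpha> \<beta>] h(1-4) by blast
  next
    fix X u v \<gamma>
    assume u: "u \<in> hom1 K X A" "v \<in> hom1 K X B" "\<gamma> \<in> hom2 K (f \<cdot> u) (g \<cdot> v)"
    note [simp] = u[unfolded hom_def, simplified]
    from fib show "\<exists>t \<rho> \<tau>. t \<in> hom1 K X P \<and> \<rho> \<in> hom2 K u (p \<cdot> t) \<and> \<tau> \<in> hom2 K (q \<cdot> t) v \<and>
        (g \<rhd> \<tau>) \<bullet> ((id2 K (f \<cdot> p) \<lhd> t) \<bullet> (f \<rhd> \<rho>)) = \<gamma> \<and> stably_lifting K g \<tau>"
    proof
      \<comment> \<open>The lift of \<gamma> ends at some \<open>u'\<close> with
        \<open>f u' = g v\<close>, so \<open>u'\<close> and \<open>v\<close> form a cone; \<rho> is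
        the lift and \<tau> an identity.\<close>
      assume "opfibration K f"
      then obtain u' \<alpha> where u': "u' \<in> hom1 K X A" "\<alpha> \<in> hom2 K u u'" "f \<cdot> u' = g \<cdot> v" "f \<rhd> \<alpha> = \<gamma>"
        by (rule opfibration_lift[OF _ f(3) _ u(1,3)]) (auto simp: hom_def)
      obtain t where t: "t \<in> hom1 K X P" "p \<cdot> t = u'" "q \<cdot> t = v"
        using arr[rule_format, OF u'(1) u(2) u'(3)] by blast
      note [simp] = u'(1,2)[unfolded hom_def, simplified] t(1)[unfolded hom_def, simplified]
      show ?thesis
        using u' t stably_lifting_id2[OF f(4) u(2)]
        by (intro exI[of _ t] exI[of _ \<alpha>] exI[of _ "id2 K v"]) (simp add: hom_def)
    next
      \<comment> \<open>Dually the lift starts at some \<open>v'\<close> with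
        \<open>g v' = f u\<close>, so \<open>u\<close> and \<open>v'\<close> form a cone; \<rho> is
        an identity and \<tau> the lift \<beta>.\<close>
      assume "fibration K g"
      then obtain v' \<beta> where v': "v' \<in> hom1 K X B" "\<beta> \<in> hom2 K v' v" "g \<cdot> v' = f \<cdot> u" "g \<rhd> \<beta> = \<gamma>"
          "stably_lifting K g \<beta>"
        by (rule fibration_lift[OF _ f(4) _ u(2,3)]) (auto simp: hom_def)
      obtain t where t: "t \<in> hom1 K X P" "p \<cdot> t = u" "q \<cdot> t = v'"
        using arr[rule_format, OF u(1) v'(1) v'(3)[symmetric]] by blast
      note [simp] = v'(1,2)[unfolded hom_def, simplified] t(1)[unfolded hom_def, simplified]
      show ?thesis
        using v' t
        by (intro exI[of _ t] exI[of _ "id2 K u"] exI[of _ \<beta>]) (simp add: hom_def)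
    qed
  qed
qed

section \<open>Equivalences and exactness of bipullback squares\<close>

text \<open>Conjugating \<open>e' e \<gamma>\<close> by the isomorphism \<delta> from
  \<open>e' e\<close> to the identity returns \<gamma>, so \<gamma> is determined by
  \<open>e \<gamma>\<close>.\<close>

lemma equivalence_faithful:
  assumes "equivalence K e" "e \<in> hom1 K P I" "a \<in> hom1 K X P" "\<alpha> \<in> hom2 K a b" "\<beta> \<in> hom2 K a b"
    and eq: "e \<rhd> \<alpha> = e \<rhd> \<beta>"
  shows "\<alpha> = \<beta>"
proof -
  note [simp] = assms(2-5)[unfolded hom_def, simplified]
  have b: "b \<in> hom1 K X P"
    using arr2_simps[of \<alpha>] by (simp add: hom_def)
  note [simp] = b[unfolded hom_def, simplified]
  have [simp]: "P \<in> Obj (ucat K)"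
    using arr1_obj[of e] by simp
  obtain e' \<delta> where e': "e' \<in> hom1 K I P" and \<delta>: "\<delta> \<in> hom2 K (e' \<cdot> e) (id1 K P)" "\<delta> \<in> isos (vcat K)"
    using assms(1) by (auto simp: equivalence_def)
  obtain \<delta>' where \<delta>': "\<delta>' \<in> hom2 K (id1 K P) (e' \<cdot> e)" "\<delta> \<bullet> \<delta>' = id2 K (id1 K P)"
    by (rule isos_obtain[OF \<delta>(2,1)]) blast
  note [simp] = e'[unfolded hom_def, simplified] \<delta>(1)[unfolded hom_def, simplified]
    \<delta>'(1)[unfolded hom_def, simplified]
  have conj: "\<gamma> = (\<delta> \<lhd> b) \<bullet> ((e' \<rhd> (e \<rhd> \<gamma>)) \<bullet> (\<delta>' \<lhd> a))" if "\<gamma> \<in> hom2 K a b" for \<gamma>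
  proof -
    note [simp] = that[unfolded hom_def, simplified]
    have "(id1 K P \<rhd> \<gamma>) \<bullet> (\<delta> \<lhd> a) = (\<delta> \<lhd> b) \<bullet> ((e' \<cdot> e) \<rhd> \<gamma>)"
      by (rule whisker_exchange) simp_all
    then have "(\<delta> \<lhd> b) \<bullet> ((e' \<cdot> e) \<rhd> \<gamma>) \<bullet> (\<delta>' \<lhd> a) = \<gamma> \<bullet> ((\<delta> \<bullet> \<delta>') \<lhd> a)"
      by (simp flip: vcomp_assoc)
    then show ?thesis
      by (simp add: \<delta>'(2))
  qed
  show ?thesis
    using conj[OF assms(4)] conj[OF assms(5)] eq by simp
qed

text \<open>The preimage is the conjugate of \<open>e' \<gamma>\<close> by \<delta>. That it maps to
  \<gamma> is first seen after applying \<open>e'\<close>, which can be cancelled because it is an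
  equivalence as well and hence faithful.\<close>

lemma equivalence_full:
  assumes "equivalence K e" "e \<in> hom1 K P I" "a \<in> hom1 K X P" "b \<in> hom1 K X P"
    "\<gamma> \<in> hom2 K (e \<cdot> a) (e \<cdot> b)"
  obtains \<alpha> where "\<alpha> \<in> hom2 K a b" "e \<rhd> \<alpha> = \<gamma>"
proof -
  note [simp] = assms(2-5)[unfolded hom_def, simplified]
  have [simp]: "P \<in> Obj (ucat K)" "I \<in> Obj (ucat K)"
    using arr1_obj[of e] by auto
  obtain e' \<delta> where e': "e' \<in> hom1 K I P" and \<delta>: "\<delta> \<in> hom2 K (e' \<cdot> e) (id1 K P)" "\<delta> \<in> isos (vcat K)"
    and equiv': "equivalence K e'"
  proof -
    have e: "cod1 K e = I" "dom1 K e = P"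
      by simp_all
    obtain e' \<delta> \<epsilon> where e': "e' \<in> hom1 K I P" and \<delta>: "\<delta> \<in> hom2 K (e' \<cdot> e) (id1 K P)" "\<delta> \<in> isos (vcat K)"
        and \<epsilon>: "\<epsilon> \<in> hom2 K (e \<cdot> e') (id1 K I)" "\<epsilon> \<in> isos (vcat K)"
      using assms(1) unfolding equivalence_def e by blast
    have "e' \<in> Arr (ucat K)" "dom1 K e' = I" "cod1 K e' = P"
      using e' by (simp_all add: hom_def)
    then have "equivalence K e'"
      using assms(2) \<delta> \<epsilon> unfolding equivalence_def by auto
    then show ?thesis
      using that e' \<delta> by blast
  qed
  obtain \<delta>' where \<delta>': "\<delta>' \<in> hom2 K (id1 K P) (e' \<cdot> e)" "\<delta>' \<bullet> \<delta> = id2 K (e' \<cdot> e)"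
      "\<delta> \<bullet> \<delta>' = id2 K (id1 K P)"
    by (rule isos_obtain[OF \<delta>(2,1)]) blast
  note [simp] = e'[unfolded hom_def, simplified] \<delta>(1)[unfolded hom_def, simplified]
    \<delta>'(1)[unfolded hom_def, simplified]
  define \<alpha> where "\<alpha> = (\<delta> \<lhd> b) \<bullet> ((e' \<rhd> \<gamma>) \<bullet> (\<delta>' \<lhd> a))"
  have \<alpha>: "\<alpha> \<in> hom2 K a b"
    by (simp add: \<alpha>_def hom_def)
  note [simp] = \<alpha>[unfolded hom_def, simplified]
  have cancel: "(\<delta>' \<lhd> x) \<bullet> (\<delta> \<lhd> x) = id2 K (e' \<cdot> (e \<cdot> x))" if "x \<in> hom1 K X P" for x
  proof -
    note [simp] = that[unfolded hom_def, simplified]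
    have "(\<delta>' \<lhd> x) \<bullet> (\<delta> \<lhd> x) = (\<delta>' \<bullet> \<delta>) \<lhd> x"
      by simp
    then show ?thesis
      by (simp only: \<delta>'(2)) simp
  qed
  have "(\<delta> \<lhd> b) \<bullet> ((e' \<cdot> e) \<rhd> \<alpha>) = (id1 K P \<rhd> \<alpha>) \<bullet> (\<delta> \<lhd> a)"
    by (rule whisker_exchange[symmetric]) simp_all
  also have "\<dots> = (\<delta> \<lhd> b) \<bullet> (e' \<rhd> \<gamma>)"
    by (simp add: \<alpha>_def cancel[OF assms(3)])
  finally have "((\<delta>' \<lhd> b) \<bullet> (\<delta> \<lhd> b)) \<bullet> ((e' \<cdot> e) \<rhd> \<alpha>) = ((\<delta>' \<lhd> b) \<bullet> (\<delta> \<lhd> b)) \<bullet> (e' \<rhd> \<gamma>)"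
    by simp
  then have eq: "e' \<rhd> (e \<rhd> \<alpha>) = e' \<rhd> \<gamma>"
    by (simp only: cancel[OF assms(4)]) simp
  have "e \<rhd> \<alpha> = \<gamma>"
    by (rule equivalence_faithful[OF equiv' e' _ _ _ eq, where X = X and a = "e \<cdot> a" and b = "e \<cdot> b"]) (simp_all add: hom_def)
  then show ?thesis
    using that \<alpha> by blast
qed

text \<open>Through the equivalence \<open>e\<close>, \<open>P\<close> inherits the universal
  property of the isocomma object up to isomorphism: fullness of \<open>e\<close> gives the filling
  of 2-cells, and \<open>fill\<close> takes the place of strict factorisation of cones.\<close>

theorem exact_bipullback:
  assumes "has_commas K" and bp: "is_bipullback K f g p q \<phi>"
    and fib: "bi_opfibration K f \<or> bi_fibration K g"
  shows "exact K f g p q \<phi>"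
proof -
  obtain P A B C where f: "p \<in> hom1 K P A" "q \<in> hom1 K P B" "f \<in> hom1 K A C" "g \<in> hom1 K B C"
      "\<phi> \<in> hom2 K (f \<cdot> p) (g \<cdot> q)" and \<phi>: "\<phi> \<in> isos (vcat K)"
    using bp unfolding is_bipullback_def lax_square_def by blast
  note [simp] = f[unfolded hom_def, simplified]
  obtain r s \<kappa> e where comma: "comma_wrt (isos (vcat K)) K f g r s \<kappa>"
      and e: "e \<in> hom1 K (dom1 K p) (dom1 K r)" "r \<cdot> e = p" "s \<cdot> e = q" "\<kappa> \<lhd> e = \<phi>"
      and equiv: "equivalence K e"
    using bp unfolding is_bipullback_def is_isocomma_def by blast
  obtain I where r: "r \<in> hom1 K I A" "s \<in> hom1 K I B" "\<kappa> \<in> hom2 K (f \<cdot> r) (g \<cdot> s)"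
    by (rule comma_wrt_square[OF comma f(3,4)])
  note [simp] = r[unfolded hom_def, simplified] e(2-4)
  have eP: "e \<in> hom1 K P I"
    using e(1) by simp
  note [simp] = eP[unfolded hom_def, simplified]
  have [simp]: "r \<cdot> (e \<cdot> x) = p \<cdot> x" "s \<cdot> (e \<cdot> x) = q \<cdot> x"
    if "x \<in> Arr (ucat K)" "cod1 K x = P" for x
    using that by (simp_all flip: comp1_assoc)
  have [simp]: "\<kappa> \<lhd> (e \<cdot> x) = \<phi> \<lhd> x" if "x \<in> Arr (ucat K)" "cod1 K x = P" for x
  proof -
    have "\<kappa> \<lhd> (e \<cdot> x) = (\<kappa> \<lhd> e) \<lhd> x"
      using that by (simp del: e(4))
    then show ?thesis
      by simp
  qed
  have [simp]: "I \<in> Obj (ucat K)"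
    using arr1_obj[of r] by simp
  obtain e' \<epsilon> where e': "e' \<in> hom1 K I P" and \<epsilon>: "\<epsilon> \<in> hom2 K (e \<cdot> e') (id1 K I)" "\<epsilon> \<in> isos (vcat K)"
    using equiv by (auto simp: equivalence_def)
  obtain \<epsilon>' where \<epsilon>': "\<epsilon>' \<in> hom2 K (id1 K I) (e \<cdot> e')" "\<epsilon> \<bullet> \<epsilon>' = id2 K (id1 K I)"
    by (rule isos_obtain[OF \<epsilon>(2,1)]) blast
  note [simp] = e'[unfolded hom_def, simplified] \<epsilon>(1)[unfolded hom_def, simplified]
    \<epsilon>'(1)[unfolded hom_def, simplified]
  \<comment> \<open>The isocomma object classifies \<alpha> by an arrow \<open>t\<close> into
    \<open>I\<close>, which \<open>e'\<close> sends into \<open>P\<close>. The isomorphism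
    \<epsilon> from \<open>e e' t\<close> to \<open>t\<close> supplies \<tau> after projection by
    \<open>s\<close>, and \<epsilon>' supplies \<sigma> after projection by
    \<open>r\<close>.\<close>
  have fill: "\<exists>t \<sigma> \<tau>. t \<in> hom1 K X P \<and> \<sigma> \<in> hom2 K u (p \<cdot> t) \<and> \<tau> \<in> hom2 K (q \<cdot> t) v \<and>
        \<tau> \<in> isos (vcat K) \<and> (g \<rhd> \<tau>) \<bullet> ((\<phi> \<lhd> t) \<bullet> (f \<rhd> \<sigma>)) = \<alpha>"
    if u: "u \<in> hom1 K X A" "v \<in> hom1 K X B" "\<alpha> \<in> hom2 K (f \<cdot> u) (g \<cdot> v)" "\<alpha> \<in> isos (vcat K)"
    for X u v \<alpha>
  proof -
    obtain t where t: "t \<in> hom1 K X I" "r \<cdot> t = u" "s \<cdot> t = v" "\<kappa> \<lhd> t = \<alpha>"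
      by (rule comma_wrt_arr[OF comma r(1) f(3,4) u])
    note [simp] = u(1-3)[unfolded hom_def, simplified] t(1)[unfolded hom_def, simplified] t(2-4)
    have "((g \<cdot> s) \<rhd> (\<epsilon> \<lhd> t)) \<bullet> (\<kappa> \<lhd> (e \<cdot> (e' \<cdot> t))) = (\<kappa> \<lhd> t) \<bullet> ((f \<cdot> r) \<rhd> (\<epsilon> \<lhd> t))"
      by (rule whisker_exchange) simp_all
    then have "((g \<cdot> s) \<rhd> (\<epsilon> \<lhd> t)) \<bullet> ((\<phi> \<lhd> (e' \<cdot> t)) \<bullet> ((f \<cdot> r) \<rhd> (\<epsilon>' \<lhd> t)))
        = \<alpha> \<bullet> ((f \<cdot> r) \<rhd> ((\<epsilon> \<bullet> \<epsilon>') \<lhd> t))"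
      by (simp flip: vcomp_assoc)
    also have "\<dots> = \<alpha>"
      by (simp only: \<epsilon>'(2)) simp
    finally show ?thesis
      by (intro exI[of _ "e' \<cdot> t"] exI[of _ "r \<rhd> (\<epsilon>' \<lhd> t)"] exI[of _ "s \<rhd> (\<epsilon> \<lhd> t)"])
        (simp add: hom_def isos_whisker_left isos_whisker_right \<epsilon>(2))
  qed
  show ?thesis
  proof (rule exact_of_lifts[OF assms(1) f(3,4,1,2,5) \<phi>])
    fix X h k \<alpha> \<beta>
    assume h: "h \<in> hom1 K X P" "k \<in> hom1 K X P" "\<alpha> \<in> hom2 K (p \<cdot> h) (p \<cdot> k)"
      "\<beta> \<in> hom2 K (q \<cdot> h) (q \<cdot> k)" "(\<phi> \<lhd> k) \<bullet> (f \<rhd> \<alpha>) = (g \<rhd> \<beta>) \<bullet> (\<phi> \<lhd> h)"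
    note [simp] = h(1-4)[unfolded hom_def, simplified]
    \<comment> \<open>The components are filled in the isocomma object first; the filler is then
      lifted along \<open>e\<close> by fullness.\<close>
    have "\<exists>!\<gamma>. \<gamma> \<in> hom2 K (e \<cdot> h) (e \<cdot> k) \<and> r \<rhd> \<gamma> = \<alpha> \<and> s \<rhd> \<gamma> = \<beta>"
      by (rule comma_wrt_cell[OF comma r(1), of _ X]) (simp_all add: hom_def h(5))
    then obtain \<gamma> where \<gamma>: "\<gamma> \<in> hom2 K (e \<cdot> h) (e \<cdot> k)" "r \<rhd> \<gamma> = \<alpha>" "s \<rhd> \<gamma> = \<beta>"
      by blast
    obtain \<gamma>' where \<gamma>': "\<gamma>' \<in> hom2 K h k" "e \<rhd> \<gamma>' = \<gamma>"
      by (rule equivalence_full[OF equiv eP h(1,2) \<gamma>(1)])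
    note [simp] = \<gamma>'(1)[unfolded hom_def, simplified]
    have "r \<rhd> (e \<rhd> \<gamma>') = p \<rhd> \<gamma>'" "s \<rhd> (e \<rhd> \<gamma>') = q \<rhd> \<gamma>'"
      by simp_all
    then show "\<exists>\<gamma> \<in> hom2 K h k. p \<rhd> \<gamma> = \<alpha> \<and> q \<rhd> \<gamma> = \<beta>"
      using \<gamma> \<gamma>' by auto
  next
    fix X u v \<gamma>
    assume u: "u \<in> hom1 K X A" "v \<in> hom1 K X B" "\<gamma> \<in> hom2 K (f \<cdot> u) (g \<cdot> v)"
    note [simp] = u[unfolded hom_def, simplified]
    from fib show "\<exists>t \<rho> \<tau>. t \<in> hom1 K X P \<and> \<rho> \<in> hom2 K u (p \<cdot> t) \<and> \<tau> \<in> hom2 K (q \<cdot> t) v \<and>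
        (g \<rhd> \<tau>) \<bullet> ((\<phi> \<lhd> t) \<bullet> (f \<rhd> \<rho>)) = \<gamma> \<and> stably_lifting K g \<tau>"
    proof
      assume "bi_opfibration K f"
      then obtain u' \<alpha> \<theta> where u': "u' \<in> hom1 K X A" "\<alpha> \<in> hom2 K u u'" "\<theta> \<in> hom2 K (f \<cdot> u') (g \<cdot> v)"
          "\<theta> \<in> isos (vcat K)" "\<theta> \<bullet> (f \<rhd> \<alpha>) = \<gamma>"
        by (rule bi_opfibration_lift[OF _ f(3) _ u(1,3)]) (auto simp: hom_def)
      \<comment> \<open>\<open>f u'\<close> agrees with \<open>g v\<close> only up to \<theta>, so
        \<open>fill\<close> is applied to \<theta> where the strict case used a cone; \<sigma> is
        then absorbed into \<rho>.\<close>
      obtain t \<sigma> \<tau> where t: "t \<in> hom1 K X P" "\<sigma> \<in> hom2 K u' (p \<cdot> t)" "\<tau> \<in> hom2 K (q \<cdot> t) v"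
          "\<tau> \<in> isos (vcat K)" "(g \<rhd> \<tau>) \<bullet> ((\<phi> \<lhd> t) \<bullet> (f \<rhd> \<sigma>)) = \<theta>"
        using fill[OF u'(1) u(2) u'(3,4)] by blast
      note [simp] = u'(1-3)[unfolded hom_def, simplified] t(1-3)[unfolded hom_def, simplified]
      \<comment> \<open>Inserting the identity presents the invertible \<tau> as a stably lifting
        2-cell precomposed with an isomorphism.\<close>
      have "stably_lifting K g (id2 K v \<bullet> \<tau>)"
        by (rule stably_lifting_vcomp_iso[OF f(4) _ t(3) _ t(4) stably_lifting_id2[OF f(4) u(2)]])
          (auto simp: hom_def)
      then show ?thesis
        using u'(5) t
        by (intro exI[of _ t] exI[of _ "\<sigma> \<bullet> \<alpha>"] exI[of _ \<tau>]) (auto simp: hom_def)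
    next
      assume "bi_fibration K g"
      then obtain v' \<beta> \<theta> where v': "v' \<in> hom1 K X B" "\<beta> \<in> hom2 K v' v" "\<theta> \<in> hom2 K (f \<cdot> u) (g \<cdot> v')"
          "\<theta> \<in> isos (vcat K)" "(g \<rhd> \<beta>) \<bullet> \<theta> = \<gamma>" "stably_lifting K g \<beta>"
        by (rule bi_fibration_lift[OF _ f(4) _ u(2,3)]) (auto simp: hom_def)
      obtain t \<sigma> \<tau> where t: "t \<in> hom1 K X P" "\<sigma> \<in> hom2 K u (p \<cdot> t)" "\<tau> \<in> hom2 K (q \<cdot> t) v'"
          "\<tau> \<in> isos (vcat K)" "(g \<rhd> \<tau>) \<bullet> ((\<phi> \<lhd> t) \<bullet> (f \<rhd> \<sigma>)) = \<theta>"
        using fill[OF u(1) v'(1,3,4)] by blast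
      note [simp] = v'(1-3)[unfolded hom_def, simplified] t(1-3)[unfolded hom_def, simplified]
      \<comment> \<open>Here the correction \<tau> from \<open>fill\<close> is absorbed into the
        lift \<beta>, which stays stably lifting.\<close>
      have "stably_lifting K g (\<beta> \<bullet> \<tau>)"
        by (rule stably_lifting_vcomp_iso[OF f(4) _ t(3) v'(2) t(4) v'(6)]) (auto simp: hom_def)
      then show ?thesis
        using v'(5) t
        by (intro exI[of _ t] exI[of _ \<sigma>] exI[of _ "\<beta> \<bullet> \<tau>"]) (auto simp: hom_def)
    qed
  qed
qed

end

theorem proposition4p3p4:
  fixes K :: "('o, 'a, 'c) two_cat" (structure)
  assumes "two_category K" and "has_commas K" and "has_pullbacks K"
  shows "(\<forall>f g p q. is_pullback K f g p q \<and> (opfibration K f \<or> fibration K g) \<longrightarrow>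
            exact K f g p q (id2 K (f \<cdot> p))) \<and>
         (has_isocommas K \<longrightarrow>
            (\<forall>f g p q \<phi>. is_bipullback K f g p q \<phi> \<and> (bi_opfibration K f \<or> bi_fibration K g) \<longrightarrow>
               exact K f g p q \<phi>))"
proof -
  interpret two_category K
    by (rule assms(1))
  show ?thesis
    using exact_pullback[OF assms(2)] exact_bipullback[OF assms(2)] by blast
qed

end
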